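(* Let $n\ge 2$ and $c\in(0,1)$. The standard Poisson sphere $(\mathbb{S}^{2n-3},\rho^{(n-1)})$ is embedded in the nonstandard Poisson projective space $(\mathbb{C}P^{n-1},\tau_c)$; that is, there is a smooth embedding $f:\mathbb{S}^{2n-3}\to\mathbb{C}P^{n-1}$ with $(Df)_x(\rho^{(n-1)}(x))=\tau_c(f(x))$ for all $x\in\mathbb{S}^{2n-3}$.
   Context: Let $e_{ij}$ be the matrix units. A Poisson structure on a manifold $M$ is identified with its Poisson 2-tensor (bivector field) in $\Gamma(\wedge^2TM)$. For a Lie group $G$, $L_g$ and $R_g$ denote left and right translation by $g$ and also the maps they induce on tangent vectors and 2-tensors. Standard Poisson $SU(m)$: for $1\le i<j\le m$ let $X_{ij}^+=e_{ij}-e_{ji}$ and $X_{ij}^-=\sqrt{-1}\,(e_{ij}+e_{ji})$, elements of $\mathfrak{su}(m)$, let $r=\sum_{1\le i<j\le m}X_{ij}^+\wedge X_{ij}^-$, and set $\pi^{(m)}(u)=L_u r-R_u r$ for $u\in SU(m)$. This is a multiplicative Poisson structure on $SU(m)$. Standard Poisson sphere: for $m\ge2$, $\{1\}\oplus SU(m-1)$ is a Poisson-Lie subgroup of $(SU(m),\pi^{(m)})$, and $\rho^{(m)}$ is the Poisson structure on $\mathbb{S}^{2m-1}\cong SU(m)/[\{1\}\oplus SU(m-1)]$ (where $u\in SU(m)$ is mapped to its first column) obtained by pushing $\pi^{(m)}$ forward along the quotient map. By definition $\rho^{(1)}=0$ on $\mathbb{S}^1$. Nonstandard Poisson projective space: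 let $\pi=\pi^{(n)}$, let $U(n-1)\subset SU(n)$ denote the subgroup $\{\det(u)^{-1}\oplus u: u\text{ an }(n-1)\times(n-1)\text{ unitary matrix}\}$, and identify $SU(n)/U(n-1)$ with $\mathbb{C}P^{n-1}$ by sending $u\in SU(n)$ to the complex line spanned by its first column. For $c\in[0,1]$ let $$\sigma_c=\sqrt{c}\,e_{11}+\sqrt{1-c}\,e_{n1}-\sqrt{1-c}\,e_{1n}+\sqrt{c}\,e_{nn}+\sum_{i=2}^{n-1}e_{ii}\in SU(n),$$ and let $\pi_{\sigma_c}(g)=R_{\sigma_c}(\pi(g\sigma_c^{-1}))$, the push-forward of $\pi$ by right translation by $\sigma_c$. The 2-tensor $\pi_{\sigma_c}$ descends along the quotient map $\phi:SU(n)\to\mathbb{C}P^{n-1}$ to a well-defined Poisson structure $\tau_c$ on $\mathbb{C}P^{n-1}$: $\tau_c(\phi(u))=(D\phi)_u(\pi_{\sigma_c}(u))$ for all $u\in SU(n)$. *)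

theory Defs
  imports "HOL-Analysis.Analysis"
begin

section \<open>Smooth maps and tangent vectors on subsets of a Euclidean space\<close>

primrec Ck_on :: "nat \<Rightarrow> 'a::real_normed_vector set \<Rightarrow> ('a \<Rightarrow> 'b::real_normed_vector) \<Rightarrow> bool" where
  "Ck_on 0 W g \<longleftrightarrow> continuous_on W g"
| "Ck_on (Suc k) W g \<longleftrightarrow>
     (\<forall>x\<in>W. g differentiable (at x)) \<and>
     (\<forall>v. Ck_on k W (\<lambda>x. frechet_derivative g (at x) v))"

text \<open>The set \<open>W\<close> is meant to be open.\<close>

definition smooth_on :: "'a::real_normed_vector set \<Rightarrow> ('a \<Rightarrow> 'b::real_normed_vector) \<Rightarrow> bool" where
  "smooth_on W g \<longleftrightarrow> (\<forall>k. Ck_on k W g)"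

definition tangent_space :: "'a::real_normed_vector set \<Rightarrow> 'a \<Rightarrow> 'a set" where
  "tangent_space M x = {v. \<exists>\<gamma>::real \<Rightarrow> 'a.
     (\<forall>t. \<gamma> t \<in> M) \<and> \<gamma> 0 = x \<and> (\<gamma> has_vector_derivative v) (at 0)}"


section \<open>Bivectors\<close>

text \<open>
  An element of the second exterior power of a finite-dimensional real vector space \<open>V\<close> is
  represented by the alternating bilinear form that it induces on the dual space of \<open>V\<close>. For a
  submanifold \<open>M\<close> of \<open>V\<close>, a bivector tangent to \<open>M\<close> at \<open>x\<close> is regarded as a bivector of \<open>V\<close>.
\<close>

type_synonym 'a bivector = "('a \<Rightarrow>\<^sub>L real) \<Rightarrow> ('a \<Rightarrow>\<^sub>L real) \<Rightarrow> real"

definition wedge :: "'a::real_normed_vector \<Rightarrow> 'a \<Rightarrow> 'a bivector" where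
  "wedge v w = (\<lambda>\<alpha> \<beta>. blinfun_apply \<alpha> v * blinfun_apply \<beta> w - blinfun_apply \<alpha> w * blinfun_apply \<beta> v)"

definition map_bivector ::
  "('a::real_normed_vector \<Rightarrow>\<^sub>L 'b::real_normed_vector) \<Rightarrow> 'a bivector \<Rightarrow> 'b bivector" where
  "map_bivector T B = (\<lambda>\<alpha> \<beta>. B (\<alpha> o\<^sub>L T) (\<beta> o\<^sub>L T))"

text \<open>
  The image of a bivector \<open>B\<close>, tangent to the submanifold \<open>M\<close> at \<open>x\<close>, under the differential of a
  map \<open>g\<close> defined on \<open>M\<close>. The derivative of \<open>g\<close> at \<open>x\<close> within \<open>M\<close> is determined only on the
  tangent space of \<open>M\<close> at \<open>x\<close>; the image of a tangent bivector does not depend on the choice made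
  by \<^const>\<open>frechet_derivative\<close>.
\<close>

definition push :: "'a::real_normed_vector set \<Rightarrow> ('a \<Rightarrow> 'b::real_normed_vector) \<Rightarrow> 'a
    \<Rightarrow> 'a bivector \<Rightarrow> 'b bivector" where
  "push M g x B = map_bivector (Blinfun (frechet_derivative g (at x within M))) B"


section \<open>Complex projective space\<close>

type_synonym 'n cvec = "(complex, 'n) vec"
type_synonym 'n cmat = "((complex, 'n) vec, 'n) vec"

definition CP :: "('n::finite) cvec set set" where
  "CP = {vec.span {z} | z. z \<noteq> 0}"

definition CP_topology :: "('n::finite) cvec set topology" where
  "CP_topology = topology (\<lambda>U. U \<subseteq> CP \<and> open {z. z \<noteq> 0 \<and> vec.span {z} \<in> U})"

lemma openin_CP_topology:
  "openin CP_topology U \<longleftrightarrow> U \<subseteq> CP \<and> open {z. z \<noteq> 0 \<and> vec.span {z} \<in> U}"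
  for U :: "('n::finite) cvec set set"
proof -
  have *: "{z. z \<noteq> 0 \<and> vec.span {z} \<in> \<Union>\<K>} = (\<Union>U\<in>\<K>. {z. z \<noteq> 0 \<and> vec.span {z} \<in> U})"
    for \<K> :: "'n cvec set set set"
    by auto
  have **: "{z. z \<noteq> 0 \<and> vec.span {z} \<in> S \<inter> T} =
      {z. z \<noteq> 0 \<and> vec.span {z} \<in> S} \<inter> {z. z \<noteq> 0 \<and> vec.span {z} \<in> T}"
    for S T :: "'n cvec set set"
    by auto
  have "istopology (\<lambda>U::'n cvec set set. U \<subseteq> CP \<and> open {z. z \<noteq> 0 \<and> vec.span {z} \<in> U})"
    unfolding istopology_def * ** by (auto intro!: open_Int open_UN)
  then show ?thesis
    by (simp add: CP_topology_def topology_inverse')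
qed

text \<open>
  The affine charts: the line through \<open>z\<close> with \<open>z $ i \<noteq> 0\<close> is sent to \<open>z\<close> divided by \<open>z $ i\<close>.
  The constant coordinate with index \<open>i\<close> is kept, so that the chart takes values in the affine
  hyperplane \<open>{w. w $ i = 1}\<close>.
\<close>

definition chart_dom :: "'n \<Rightarrow> ('n::finite) cvec set set" where
  "chart_dom i = {p \<in> CP. \<exists>z\<in>p. z $ i \<noteq> 0}"

definition chart :: "'n \<Rightarrow> ('n::finite) cvec set \<Rightarrow> 'n cvec" where
  "chart i p = (THE w. w \<in> p \<and> w $ i = 1)"

text \<open>
  A tangent bivector of the projective space at a point \<open>p\<close> is represented by the family of its
  coordinate expressions in all the affine charts around \<open>p\<close> (extended by zero to the charts
  whose domain does not contain \<open>p\<close>).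
\<close>

type_synonym 'n cp_bivector = "'n \<Rightarrow> 'n cvec bivector"

definition push_CP :: "'a::real_normed_vector set \<Rightarrow> ('a \<Rightarrow> 'n cvec set) \<Rightarrow> 'a
    \<Rightarrow> 'a bivector \<Rightarrow> ('n::finite) cp_bivector" where
  "push_CP M f x B =
     (\<lambda>i. if f x \<in> chart_dom i then push M (\<lambda>y. chart i (f y)) x B else (\<lambda>\<alpha> \<beta>. 0))"

definition smooth_map_CP ::
  "'a::real_normed_vector set \<Rightarrow> ('a \<Rightarrow> ('n::finite) cvec set) \<Rightarrow> bool" where
  "smooth_map_CP M f \<longleftrightarrow> f ` M \<subseteq> CP \<and>
     (\<forall>x\<in>M. \<forall>i. f x \<in> chart_dom i \<longrightarrow>
        (\<exists>W g. open W \<and> x \<in> W \<and> smooth_on W g \<and>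
           (\<forall>y\<in>M \<inter> W. f y \<in> chart_dom i \<and> chart i (f y) = g y)))"

definition immersion_CP ::
  "'a::real_normed_vector set \<Rightarrow> ('a \<Rightarrow> ('n::finite) cvec set) \<Rightarrow> bool" where
  "immersion_CP M f \<longleftrightarrow>
     (\<forall>x\<in>M. \<forall>i. f x \<in> chart_dom i \<longrightarrow>
        inj_on (frechet_derivative (\<lambda>y. chart i (f y)) (at x within M)) (tangent_space M x))"

definition smooth_embedding_CP ::
  "'a::real_normed_vector set \<Rightarrow> ('a \<Rightarrow> ('n::finite) cvec set) \<Rightarrow> bool" where
  "smooth_embedding_CP M f \<longleftrightarrow>
     smooth_map_CP M f \<and> immersion_CP M f \<and> embedding_map (top_of_set M) CP_topology f"


section \<open>The standard Poisson structure on the special unitary group\<close>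

text \<open>
  The rows and columns of matrices are indexed by a finite linearly ordered type \<open>'n\<close>, which
  plays the role of the ordered set of the natural numbers from 1 to \<open>CARD('n)\<close>.
\<close>

definition first :: "'n::{finite,linorder}" where "first = Min UNIV"
definition final :: "'n::{finite,linorder}" where "final = Max UNIV"

definition SU :: "('n::finite) cmat set" where
  "SU = {u. (\<chi> i j. cnj (u $ j $ i)) ** u = mat 1 \<and> det u = 1}"

definition mat_unit :: "'n \<Rightarrow> 'n \<Rightarrow> ('n::finite) cmat" where
  "mat_unit i j = (\<chi> k l. if k = i \<and> l = j then 1 else 0)"

definition Xp :: "'n \<Rightarrow> 'n \<Rightarrow> ('n::finite) cmat" where
  "Xp i j = mat_unit i j - mat_unit j i"

definition Xm :: "'n \<Rightarrow> 'n \<Rightarrow> ('n::finite) cmat" where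
  "Xm i j = mat \<i> ** (mat_unit i j + mat_unit j i)"

definition r_SU :: "('n::{finite,linorder}) cmat bivector" where
  "r_SU = (\<lambda>\<alpha> \<beta>. \<Sum>(i, j)\<in>{(i, j). i < j}. wedge (Xp i j) (Xm i j) \<alpha> \<beta>)"

definition left_mult :: "('n::finite) cmat \<Rightarrow> 'n cmat bivector \<Rightarrow> 'n cmat bivector" where
  "left_mult u = map_bivector (Blinfun (\<lambda>A. u ** A))"

definition right_mult :: "('n::finite) cmat \<Rightarrow> 'n cmat bivector \<Rightarrow> 'n cmat bivector" where
  "right_mult u = map_bivector (Blinfun (\<lambda>A. A ** u))"

definition poisson_SU :: "('n::{finite,linorder}) cmat \<Rightarrow> 'n cmat bivector" where
  "poisson_SU u = (\<lambda>\<alpha> \<beta>. left_mult u r_SU \<alpha> \<beta> - right_mult u r_SU \<alpha> \<beta>)"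


section \<open>The standard Poisson sphere\<close>

text \<open>
  The push-forward along the map from the special unitary group to the sphere which sends \<open>u\<close> to
  its first column. In complex dimension one this map is not surjective onto the circle, and the
  Poisson structure is zero by convention.
\<close>

definition poisson_sphere :: "('m::{finite,linorder}) cvec \<Rightarrow> 'm cvec bivector" where
  "poisson_sphere x =
     (if CARD('m) = 1 then (\<lambda>\<alpha> \<beta>. 0)
      else (THE B. \<forall>u\<in>SU. column first u = x \<longrightarrow> B = push SU (column first) u (poisson_SU u)))"


section \<open>The nonstandard Poisson projective space\<close>

definition sigma :: "real \<Rightarrow> ('n::{finite,linorder}) cmat" where
  "sigma c = sqrt c *\<^sub>R mat_unit first first + sqrt (1 - c) *\<^sub>R mat_unit final first
     - sqrt (1 - c) *\<^sub>R mat_unit first final + sqrt c *\<^sub>R mat_unit final final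
     + (\<Sum>i\<in>UNIV - {first, final}. mat_unit i i)"

definition poisson_sigma :: "real \<Rightarrow> ('n::{finite,linorder}) cmat \<Rightarrow> 'n cmat bivector" where
  "poisson_sigma c g = right_mult (sigma c) (poisson_SU (g ** matrix_inv (sigma c)))"

definition proj_line :: "('n::{finite,linorder}) cmat \<Rightarrow> 'n cvec set" where
  "proj_line u = vec.span {column first u}"

definition tau :: "real \<Rightarrow> ('n::{finite,linorder}) cvec set \<Rightarrow> 'n cp_bivector" where
  "tau c p = (THE T. \<forall>u\<in>SU. proj_line u = p \<longrightarrow> T = push_CP SU proj_line u (poisson_sigma c u))"

end

theory Submission
  imports Defs
begin

text \<open>
  Identify a real-linear functional on \<open>\<complex>\<^sup>n\<close> with a complex covector \<open>a\<close>, acting by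
  \<open>v \<mapsto> Re (a \<cdot> v)\<close>. With \<open>\<Omega>(a, b) = Im (\<Sum>k. a\<^sub>k cnj b\<^sub>k)\<close>, which is invariant under unitary
  matrices, and \<open>S\<^sub>x\<close> the image of \<open>r\<close> under \<open>X \<mapsto> X x\<close>, the Poisson structures become
  \<open>\<rho>(x) = x \<and> ix - \<Omega> - S\<^sub>x\<close> on the sphere (also in complex dimension one, where this vanishes) and
  \<open>\<tau>\<^sub>c = (1 - 2c) \<Omega> - S\<^sub>z\<close> at the line through the unit vector \<open>z\<close>, evaluated on covectors that
  annihilate \<open>z\<close>; here \<open>(1 - 2c) \<Omega>\<close> is what remains of \<open>S\<close> at the first column of \<open>\<sigma>\<^sub>c\<close>.
  The embedding is \<open>x \<mapsto> [\<surd>c x, \<surd>(1 - c)]\<close>: the terms of \<open>S\<^sub>z\<close> that involve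
  the last index are \<open>(1 - c) \<Omega>'\<close> plus multiples of the last components of \<open>a\<close> and \<open>b\<close>, and these
  components are eliminated by means of \<open>a \<cdot> z = b \<cdot> z = 0\<close>.
\<close>

section \<open>Unitary matrices\<close>

definition conj_transpose :: "('n::finite) cmat \<Rightarrow> 'n cmat" where
  "conj_transpose u = (\<chi> i j. cnj (u $ j $ i))"

lemma conj_transpose_nth [simp]: "conj_transpose u $ i $ j = cnj (u $ j $ i)"
  by (simp add: conj_transpose_def)

lemma conj_transpose_mult: "conj_transpose (A ** B) = conj_transpose B ** conj_transpose A"
  by (simp add: vec_eq_iff matrix_matrix_mult_def mult.commute)

lemma conj_transpose_conj_transpose [simp]: "conj_transpose (conj_transpose A) = A"
  by (simp add: vec_eq_iff)

lemma conj_transpose_add: "conj_transpose (A + B) = conj_transpose A + conj_transpose B"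
  by (simp add: vec_eq_iff)

lemma conj_transpose_diff: "conj_transpose (A - B) = conj_transpose A - conj_transpose B"
  by (simp add: vec_eq_iff)

lemma conj_transpose_scaleR: "conj_transpose (c *\<^sub>R A) = c *\<^sub>R conj_transpose A"
  by (simp add: vec_eq_iff)

lemma conj_transpose_mat_1 [simp]: "conj_transpose (mat 1) = mat 1"
  by (simp add: vec_eq_iff mat_def)

lemma det_conj_transpose: "det (conj_transpose A) = cnj (det A)"
proof -
  have "conj_transpose A = transpose (\<chi> i j. cnj (A $ i $ j))"
    by (simp add: vec_eq_iff transpose_def)
  then have "det (conj_transpose A) = det (\<chi> i j. cnj (A $ i $ j))"
    by (simp add: det_transpose)
  also have "\<dots> = cnj (det A)"
    by (simp add: det_def)
  finally show ?thesis .
qed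

section \<open>Real bilinearity of the matrix product\<close>

lemma matrix_mult_add_rdistrib: "(A + B) ** C = A ** C + B ** C" for A B C :: "('n::finite) cmat"
  by (simp add: vec_eq_iff matrix_matrix_mult_def sum.distrib distrib_right)

lemma matrix_mult_diff_ldistrib: "A ** (B - C) = A ** B - A ** C" for A B C :: "('n::finite) cmat"
  by (simp add: vec_eq_iff matrix_matrix_mult_def sum_subtractf right_diff_distrib)

lemma matrix_mult_diff_rdistrib: "(A - B) ** C = A ** C - B ** C" for A B C :: "('n::finite) cmat"
  by (simp add: vec_eq_iff matrix_matrix_mult_def sum_subtractf left_diff_distrib)

lemma matrix_mult_scaleR_right: "A ** (k *\<^sub>R B) = k *\<^sub>R (A ** B)" for A B :: "('n::finite) cmat"
  by (simp add: matrix_scalar_ac scalar_matrix_assoc)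

lemma matrix_mult_minus_left: "(- A) ** B = - (A ** B)" for A B :: "('n::finite) cmat"
  by (simp add: vec_eq_iff matrix_matrix_mult_def sum_negf)

lemma matrix_mult_minus_right: "A ** (- B) = - (A ** B)" for A B :: "('n::finite) cmat"
  by (simp add: vec_eq_iff matrix_matrix_mult_def sum_negf)

lemmas cmat_algebra = matrix_add_ldistrib matrix_mult_add_rdistrib matrix_mult_diff_ldistrib
  matrix_mult_diff_rdistrib scalar_matrix_assoc [symmetric] matrix_mult_scaleR_right
  matrix_mult_minus_left matrix_mult_minus_right

lemma bounded_linear_matrix_mult_left: "bounded_linear (\<lambda>A :: 'n cmat. u ** A)" for u :: "('n::finite) cmat"
  by (auto simp: linear_conv_bounded_linear[symmetric] cmat_algebra intro!: linearI)

lemma bounded_linear_matrix_mult_right: "bounded_linear (\<lambda>A :: 'n cmat. A ** u)" for u :: "('n::finite) cmat"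
  by (auto simp: linear_conv_bounded_linear[symmetric] cmat_algebra intro!: linearI)

lemma bounded_linear_column:
  "bounded_linear (column j :: ('n::finite) cmat \<Rightarrow> 'n cvec)"
  by (auto simp: linear_conv_bounded_linear[symmetric] column_def vec_eq_iff intro!: linearI)

lemma column_mult: "column j (A ** B) = A *v column j B"
  by (simp add: vec_eq_iff column_def matrix_matrix_mult_def matrix_vector_mult_def)

lemma column_eq_mult_axis: "column j A = A *v axis j 1" for A :: "('n::finite) cmat"
  by (simp add: vec_eq_iff column_def matrix_vector_mult_def axis_def if_distrib cong: if_cong)

lemma mem_SU_iff: "u \<in> SU \<longleftrightarrow> conj_transpose u ** u = mat 1 \<and> det u = 1"
  by (simp add: SU_def conj_transpose_def)

lemma SU_mult: "u \<in> SU \<Longrightarrow> v \<in> SU \<Longrightarrow> u ** v \<in> SU"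
  by (simp add: mem_SU_iff conj_transpose_mult det_mul)
    (metis matrix_mul_assoc matrix_mul_lid)

lemma SU_conj_transpose_right: "u \<in> SU \<Longrightarrow> u ** conj_transpose u = mat 1"
  by (simp add: mem_SU_iff matrix_left_right_inverse)

lemma SU_conj_transpose: "u \<in> SU \<Longrightarrow> conj_transpose u \<in> SU"
  using SU_conj_transpose_right[of u] by (simp add: mem_SU_iff det_conj_transpose)

lemma matrix_inv_SU:
  assumes "u \<in> SU"
  shows "matrix_inv u = conj_transpose u"
proof -
  have u: "u ** conj_transpose u = mat 1" "conj_transpose u ** u = mat 1"
    using assms SU_conj_transpose_right by (auto simp: mem_SU_iff)
  \<comment> \<open>\<open>matrix_inv\<close> is a Hilbert choice, so its defining property is
    available once some two-sided inverse is exhibited.\<close>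
  then have "matrix_inv u ** u = mat 1"
    unfolding matrix_inv_def by (metis (mono_tags, lifting) someI_ex)
  then show ?thesis
    using u(1) by (metis matrix_mul_assoc matrix_mul_lid matrix_mul_rid)
qed

lemma norm_cvec_square: "complex_of_real ((norm v)\<^sup>2) = (\<Sum>k\<in>UNIV. v $ k * cnj (v $ k))"
  for v :: "('n::finite) cvec"
  by (simp add: norm_vec_def L2_set_def sum_nonneg complex_norm_square[symmetric])

lemma norm_column_SU:
  assumes "u \<in> SU"
  shows "norm (column j u) = 1"
proof -
  have "(conj_transpose u ** u) $ j $ j = 1"
    using assms by (simp add: mem_SU_iff mat_def)
  then have "(\<Sum>k\<in>UNIV. column j u $ k * cnj (column j u $ k)) = 1"
    by (simp add: matrix_matrix_mult_def column_def mult.commute)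
  then have "complex_of_real ((norm (column j u))\<^sup>2) = 1"
    using norm_cvec_square[of "column j u"] by simp
  then show ?thesis
    by (metis norm_ge_zero of_real_eq_1_iff power2_eq_1_iff neg_0_le_iff_le not_one_le_zero)
qed

lemma column_neq_0_SU: "u \<in> SU \<Longrightarrow> column j u \<noteq> 0"
  using norm_column_SU[of u j] by auto

lemma SU_orthogonal_rows:
  assumes "u \<in> SU"
  shows "(\<Sum>j\<in>UNIV. u $ k $ j * cnj (u $ l $ j)) = (if k = l then 1 else 0)"
proof -
  have "(u ** conj_transpose u) $ k $ l = (mat 1 :: 'a cmat) $ k $ l"
    using SU_conj_transpose_right[OF assms] by simp
  then show ?thesis
    by (simp add: matrix_matrix_mult_def mat_def)
qed

text \<open>
  For \<open>X = Xp i j\<close> or \<open>X = Xm i j\<close> the square of \<open>X\<close> is \<open>- P\<close>, where \<open>P\<close> is the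
  projection onto the coordinate plane of \<open>i\<close> and \<open>j\<close>; hence this is \<open>exp (t X)\<close>.
\<close>

definition rotation :: "'n \<Rightarrow> 'n \<Rightarrow> ('n::finite) cmat \<Rightarrow> real \<Rightarrow> 'n cmat" where
  "rotation i j X t = mat 1 + (cos t - 1) *\<^sub>R (mat_unit i i + mat_unit j j) + sin t *\<^sub>R X"

section \<open>Matrix units and multiplication by the scalar i\<close>

lemma mat_unit_mult: "mat_unit i j ** mat_unit k l = (if j = k then mat_unit i l else 0)"
proof -
  have "(mat_unit i j ** mat_unit k l) $ a $ b = (if j = k then mat_unit i l else 0) $ a $ b" for a b
  proof -
    have "(\<Sum>m\<in>UNIV. (if a = i \<and> m = j then 1 else 0) * (if m = k \<and> b = l then 1 else (0::complex))) =
      (\<Sum>m\<in>UNIV. if m = j then (if a = i \<and> j = k \<and> b = l then 1 else 0) else 0)"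
      by (rule sum.cong) auto
    then show ?thesis
      by (simp add: matrix_matrix_mult_def mat_unit_def)
  qed
  then show ?thesis
    by (simp add: vec_eq_iff)
qed

lemma conj_transpose_mat_unit [simp]: "conj_transpose (mat_unit i j) = mat_unit j i"
  by (auto simp: vec_eq_iff mat_unit_def)

lemma imag_mult_left: "mat \<i> ** A = (\<chi> k l. \<i> * A $ k $ l)" for A :: "('n::finite) cmat"
proof -
  have "(mat \<i> ** A) $ k $ l = \<i> * A $ k $ l" for k l
  proof -
    have "(\<Sum>m\<in>UNIV. (if k = m then \<i> else 0) * A $ m $ l) =
      (\<Sum>m\<in>UNIV. if k = m then \<i> * A $ k $ l else 0)"
      by (rule sum.cong) auto
    then show ?thesis
      by (simp add: matrix_matrix_mult_def mat_def)
  qed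
  then show ?thesis
    by (simp add: vec_eq_iff)
qed

lemma imag_mult_right: "A ** mat \<i> = mat \<i> ** A" for A :: "('n::finite) cmat"
proof -
  have "(A ** mat \<i>) $ k $ l = \<i> * A $ k $ l" for k l
  proof -
    have "(\<Sum>m\<in>UNIV. A $ k $ m * (if m = l then \<i> else 0)) =
      (\<Sum>m\<in>UNIV. if m = l then \<i> * A $ k $ l else 0)"
      by (rule sum.cong) auto
    then show ?thesis
      by (simp add: matrix_matrix_mult_def mat_def)
  qed
  then show ?thesis
    by (simp add: imag_mult_left vec_eq_iff)
qed

text \<open>Scalar matrices are central, so every factor i moves to the front and products with
  \<open>Xm\<close> reduce to products of matrix units.\<close>

lemma imag_mult_assoc:
  "A ** (mat \<i> ** B) = mat \<i> ** (A ** B)" "(mat \<i> ** A) ** B = mat \<i> ** (A ** B)"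
  for A B :: "('n::finite) cmat"
  by (metis imag_mult_right matrix_mul_assoc)+

lemma imag_mult_imag: "mat \<i> ** (mat \<i> ** A) = - A" for A :: "('n::finite) cmat"
  by (simp add: imag_mult_left vec_eq_iff flip: mult.assoc)

lemma conj_transpose_imag_mult: "conj_transpose (mat \<i> ** A) = - (mat \<i> ** conj_transpose A)"
  by (simp add: imag_mult_left vec_eq_iff)

lemma conj_transpose_Xp [simp]: "conj_transpose (Xp i j) = - Xp i j"
  by (simp add: Xp_def conj_transpose_diff)

lemma conj_transpose_Xm [simp]: "conj_transpose (Xm i j) = - Xm i j"
  by (simp add: Xm_def conj_transpose_imag_mult conj_transpose_add add.commute)

text \<open>Since P P = P, P X = X P = X and X X = - P, the product expands like one of complex
  exponentials, and the addition theorems for cosine and sine finish.\<close>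

lemma rotation_mult:
  assumes "i \<noteq> j" and X: "X = Xp i j \<or> X = Xm i j"
  shows "rotation i j X s ** rotation i j X t = rotation i j X (s + t)"
proof -
  define P :: "'a cmat" where "P = mat_unit i i + mat_unit j j"
  have PP: "P ** P = P"
    using assms(1) by (simp add: P_def cmat_algebra mat_unit_mult)
  \<comment> \<open>\<open>Xm i j\<close> is i times Q, so Q Q = P makes its square - P.\<close>
  define Q :: "'a cmat" where "Q = mat_unit i j + mat_unit j i"
  have Q: "P ** Q = Q" "Q ** P = Q" "Q ** Q = P"
    using assms(1) by (simp_all add: P_def Q_def cmat_algebra mat_unit_mult)
  have Xp: "P ** Xp i j = Xp i j" "Xp i j ** P = Xp i j" "Xp i j ** Xp i j = - P"
    using assms(1) by (simp_all add: P_def Xp_def cmat_algebra mat_unit_mult)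
  have "P ** Xm i j = Xm i j" "Xm i j ** P = Xm i j" "Xm i j ** Xm i j = - P"
    unfolding Xm_def Q_def[symmetric]
    by (simp_all add: imag_mult_assoc(1)[of P] imag_mult_assoc(1)[of Q] imag_mult_assoc(2)
        imag_mult_imag Q)
  then have PX: "P ** X = X" and XP: "X ** P = X" and XX: "X ** X = - P"
    using X Xp by auto
  show ?thesis
    unfolding rotation_def P_def[symmetric]
    by (simp add: cmat_algebra PP PX XP XX cos_add sin_add algebra_simps)
qed

lemma conj_transpose_rotation:
  "conj_transpose X = - X \<Longrightarrow> conj_transpose (rotation i j X t) = rotation i j X (- t)"
  by (simp add: rotation_def conj_transpose_add conj_transpose_scaleR)

lemma rotation_0 [simp]: "rotation i j X 0 = mat 1"
  by (simp add: rotation_def)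

text \<open>
  Conjugation by a reflection turns the rotation into its inverse, so its determinant squares
  to 1; as the rotation is itself a square, the determinant is 1.
\<close>

lemma rotation_in_SU:
  assumes "i \<noteq> j" and X: "X = Xp i j \<or> X = Xm i j"
  shows "rotation i j X t \<in> SU"
proof -
  \<comment> \<open>E kills coordinate i and fixes the others; D below is the reflection with
    diagonal entry -1 at i.\<close>
  define E :: "'a cmat" where "E = mat 1 - mat_unit i i"
  have "E ** E = E" "E ** mat_unit i i = 0" "mat_unit i i ** E = 0"
    by (simp_all add: E_def cmat_algebra mat_unit_mult)
  moreover have "E ** mat_unit i j = 0" "mat_unit i j ** E = mat_unit i j"
    "E ** mat_unit j i = mat_unit j i" "mat_unit j i ** E = 0"
    "E ** mat_unit j j = mat_unit j j" "mat_unit j j ** E = mat_unit j j"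
    using assms(1) by (simp_all add: E_def cmat_algebra mat_unit_mult)
  moreover define D where "D = E - mat_unit i i"
  ultimately have D_mult: "D ** mat_unit i i = - mat_unit i i" "mat_unit i i ** D = - mat_unit i i"
    "D ** mat_unit i j = - mat_unit i j" "mat_unit i j ** D = mat_unit i j"
    "D ** mat_unit j i = mat_unit j i" "mat_unit j i ** D = - mat_unit j i"
    "D ** mat_unit j j = mat_unit j j" "mat_unit j j ** D = mat_unit j j" "D ** D = E + mat_unit i i"
    using assms(1) by (simp_all add: cmat_algebra mat_unit_mult)
  then have DD: "D ** D = mat 1"
    by (simp add: E_def)
  define Q :: "'a cmat" where "Q = mat_unit i j + mat_unit j i"
  have "D ** Q ** D = - Q" and Xp: "D ** Xp i j ** D = - Xp i j"
    using assms(1) by (simp_all add: D_mult Q_def Xp_def cmat_algebra)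
  then have "D ** Xm i j ** D = - Xm i j"
    unfolding Xm_def Q_def[symmetric]
    by (simp add: imag_mult_assoc(1)[of D] imag_mult_assoc(2) matrix_mult_minus_right)
  with Xp have DX: "D ** X ** D = - X"
    using X by auto
  define P :: "'a cmat" where "P = mat_unit i i + mat_unit j j"
  have DP: "D ** P ** D = P"
    using assms(1) by (simp add: P_def D_mult cmat_algebra)
  have D: "D ** rotation i j X t ** D = rotation i j X (- t)" for t
    by (simp add: rotation_def P_def[symmetric] cmat_algebra DX DP DD)
  have dD: "det D * det D = 1"
    using DD by (metis det_I det_mul)
  have 1: "det (rotation i j X (- t)) = det (rotation i j X t)" for t
    using dD by (simp add: D[symmetric] det_mul mult.commute mult.left_commute)
  have "det (rotation i j X t) * det (rotation i j X (- t)) = 1" for t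
    using rotation_mult[OF assms, of t "- t"] by (metis add.right_inverse det_I det_mul rotation_0)
  then have 2: "det (rotation i j X t) * det (rotation i j X t) = 1" for t
    by (simp add: 1)
  have det: "det (rotation i j X t) = 1"
    using 2[of "t / 2"] rotation_mult[OF assms, of "t / 2" "t / 2"] by (simp flip: det_mul)
  have "conj_transpose (rotation i j X t) = rotation i j X (- t)"
    using X by (auto simp: conj_transpose_rotation)
  then show ?thesis
    using rotation_mult[OF assms, of "- t" t] det by (simp add: mem_SU_iff)
qed

lemma rotation_has_vector_derivative: "(rotation i j X has_vector_derivative X) (at 0)"
  unfolding rotation_def
  by (auto intro!: derivative_eq_intros)


section \<open>Tangent vectors and tangent bivectors\<close>

text \<open>Composing g with a curve inside M gives a function of one real variable, whose
  derivative is unique. The derivative of g within M need not be unique off the tangent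
  vectors.\<close>

lemma has_derivative_tangent_unique:
  assumes "(g has_derivative L) (at x within M)" and "(g has_derivative G) (at x within M)"
    and "v \<in> tangent_space M x"
  shows "L v = G v"
proof -
  obtain \<gamma> where \<gamma>: "\<And>t. \<gamma> t \<in> M" "\<gamma> 0 = x" "(\<gamma> has_vector_derivative v) (at 0)"
    using assms(3) by (auto simp: tangent_space_def)
  have "((g \<circ> \<gamma>) has_vector_derivative D v) (at 0)"
    if "(g has_derivative D) (at x within M)" for D
  proof -
    have "(g has_derivative D) (at (\<gamma> 0) within range \<gamma>)"
      unfolding \<gamma>(2) using \<gamma>(1) by (blast intro: has_derivative_subset[OF that])
    from diff_chain_within[OF \<gamma>(3)[unfolded has_vector_derivative_def] this]
    have "((g \<circ> \<gamma>) has_derivative D \<circ> (\<lambda>t. t *\<^sub>R v)) (at 0)" .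
    moreover have "D \<circ> (\<lambda>t. t *\<^sub>R v) = (\<lambda>t. t *\<^sub>R D v)"
      using has_derivative_bounded_linear[OF that] by (auto simp: linear_simps)
    ultimately show ?thesis
      by (simp add: has_vector_derivative_def)
  qed
  then show ?thesis
    using assms vector_derivative_unique_at by blast
qed

lemma tangent_space_image:
  assumes "v \<in> tangent_space M x" and "bounded_linear L" and "L ` M \<subseteq> N"
  shows "L v \<in> tangent_space N (L x)"
proof -
  obtain \<gamma> where \<gamma>: "\<And>t. \<gamma> t \<in> M" "\<gamma> 0 = x" "(\<gamma> has_vector_derivative v) (at 0)"
    using assms(1) by (auto simp: tangent_space_def)
  then have "((\<lambda>t. L (\<gamma> t)) has_vector_derivative L v) (at 0)"
    using bounded_linear.has_vector_derivative[OF assms(2)] by blast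
  then show ?thesis
    using \<gamma> assms(3) by (auto simp: tangent_space_def intro!: exI[of _ "\<lambda>t. L (\<gamma> t)"])
qed

text \<open>Membership in the second exterior power of T, phrased dually: B sees a functional only
  through its restriction to T. This can be checked on the set of velocities directly.\<close>

definition tangent_bivector :: "'a::real_normed_vector set \<Rightarrow> 'a bivector \<Rightarrow> bool" where
  "tangent_bivector T B \<longleftrightarrow> (\<forall>\<alpha> \<alpha>' \<beta> \<beta>'. (\<forall>v\<in>T. blinfun_apply \<alpha> v = blinfun_apply \<alpha>' v) \<longrightarrow>
     (\<forall>v\<in>T. blinfun_apply \<beta> v = blinfun_apply \<beta>' v) \<longrightarrow> B \<alpha> \<beta> = B \<alpha>' \<beta>')"

lemma tangent_bivector_diff:
  "tangent_bivector T B \<Longrightarrow> tangent_bivector T C \<Longrightarrow> tangent_bivector T (\<lambda>\<alpha> \<beta>. B \<alpha> \<beta> - C \<alpha> \<beta>)"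
  unfolding tangent_bivector_def by metis

lemma tangent_bivector_image:
  assumes "tangent_bivector T B" and "\<And>v. v \<in> T \<Longrightarrow> blinfun_apply L v \<in> T'"
  shows "tangent_bivector T' (map_bivector L B)"
  using assms unfolding tangent_bivector_def map_bivector_def by simp

text \<open>The functionals enter only through their values at the images under L of the generators
  \<open>Xp i j\<close> and \<open>Xm i j\<close>.\<close>

lemma tangent_bivector_r_SU:
  assumes "\<And>i j X. i \<noteq> j \<Longrightarrow> X = Xp i j \<or> X = Xm i j \<Longrightarrow> blinfun_apply L X \<in> T"
  shows "tangent_bivector T (map_bivector L r_SU)"
proof -
  have "r_SU (\<alpha> o\<^sub>L L) (\<beta> o\<^sub>L L) = r_SU (\<alpha>' o\<^sub>L L) (\<beta>' o\<^sub>L L)"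
    if "\<forall>v\<in>T. blinfun_apply \<alpha> v = blinfun_apply \<alpha>' v"
      "\<forall>v\<in>T. blinfun_apply \<beta> v = blinfun_apply \<beta>' v" for \<alpha> \<alpha>' \<beta> \<beta>'
  proof -
    have "wedge (Xp i j) (Xm i j) (\<alpha> o\<^sub>L L) (\<beta> o\<^sub>L L) = wedge (Xp i j) (Xm i j) (\<alpha>' o\<^sub>L L) (\<beta>' o\<^sub>L L)"
      if "i < j" for i j
      using assms[of i j "Xp i j"] assms[of i j "Xm i j"] that
        \<open>\<forall>v\<in>T. blinfun_apply \<alpha> v = blinfun_apply \<alpha>' v\<close>
        \<open>\<forall>v\<in>T. blinfun_apply \<beta> v = blinfun_apply \<beta>' v\<close> by (simp add: wedge_def)
    then show ?thesis
      by (auto simp: r_SU_def intro!: sum.cong)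
  qed
  then show ?thesis
    unfolding tangent_bivector_def map_bivector_def by blast
qed

text \<open>\<open>frechet_derivative\<close> within M is a choice, but all derivatives agree on
  tangent vectors and a tangent bivector sees nothing else. This lets push-forwards be computed with
  explicit derivatives.\<close>

lemma push_eq:
  assumes "(g has_derivative G) (at x within M)" and "tangent_bivector (tangent_space M x) B"
  shows "push M g x B = map_bivector (Blinfun G) B"
proof -
  define L where "L = frechet_derivative g (at x within M)"
  have L: "(g has_derivative L) (at x within M)"
    unfolding L_def using assms(1) by (metis differentiableI frechet_derivative_works)
  have LG: "blinfun_apply (\<alpha> o\<^sub>L Blinfun L) v = blinfun_apply (\<alpha> o\<^sub>L Blinfun G) v"
    if "v \<in> tangent_space M x" for \<alpha> :: "'b \<Rightarrow>\<^sub>L real" and v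
    using has_derivative_tangent_unique[OF L assms(1) that]
      has_derivative_bounded_linear[OF L] has_derivative_bounded_linear[OF assms(1)]
    by (simp add: bounded_linear_Blinfun_apply)
  have "B (\<alpha> o\<^sub>L Blinfun L) (\<beta> o\<^sub>L Blinfun L) = B (\<alpha> o\<^sub>L Blinfun G) (\<beta> o\<^sub>L Blinfun G)" for \<alpha> \<beta>
    by (rule assms(2)[unfolded tangent_bivector_def, rule_format]; rule LG)
  then show ?thesis
    by (simp add: push_def map_bivector_def flip: L_def)
qed

lemma map_bivector_compose: "map_bivector S (map_bivector T B) = map_bivector (S o\<^sub>L T) B"
  for S :: "'b::real_normed_vector \<Rightarrow>\<^sub>L 'c::real_normed_vector"
proof -
  have "\<alpha> o\<^sub>L (S o\<^sub>L T) = (\<alpha> o\<^sub>L S) o\<^sub>L T" for \<alpha> :: "'c \<Rightarrow>\<^sub>L real"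
    by (rule blinfun_eqI) simp
  then show ?thesis
    by (simp add: map_bivector_def)
qed

lemma map_bivector_diff:
  "map_bivector T (\<lambda>\<alpha> \<beta>. B \<alpha> \<beta> - C \<alpha> \<beta>) = (\<lambda>\<alpha> \<beta>. map_bivector T B \<alpha> \<beta> - map_bivector T C \<alpha> \<beta>)"
  by (simp add: map_bivector_def)

text \<open>The velocity at 0 of the curve u exp(t X) v in the group. The cases v = 1 and u = 1 give
  the vectors occurring in the left and right translates of r.\<close>

lemma tangent_space_SU:
  assumes "u \<in> SU" "v \<in> SU" "i \<noteq> j" "X = Xp i j \<or> X = Xm i j"
  shows "u ** X ** v \<in> tangent_space SU (u ** v)"
proof -
  have "((\<lambda>t. u ** rotation i j X t ** v) has_vector_derivative u ** X ** v) (at 0)"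
    by (intro bounded_linear.has_vector_derivative[OF bounded_linear_matrix_mult_left]
        bounded_linear.has_vector_derivative[OF bounded_linear_matrix_mult_right]
        rotation_has_vector_derivative)
  then show ?thesis
    using assms rotation_in_SU[OF assms(3,4)]
    by (auto simp: tangent_space_def SU_mult intro!: exI[of _ "\<lambda>t. u ** rotation i j X t ** v"])
qed

lemma poisson_SU_eq:
  "poisson_SU u = (\<lambda>\<alpha> \<beta>. map_bivector (Blinfun (\<lambda>A. u ** A)) r_SU \<alpha> \<beta>
     - map_bivector (Blinfun (\<lambda>A. A ** u)) r_SU \<alpha> \<beta>)"
  by (simp add: poisson_SU_def left_mult_def right_mult_def)

lemma tangent_bivector_poisson_SU:
  assumes "u \<in> SU"
  shows "tangent_bivector (tangent_space SU u) (poisson_SU u)"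
proof -
  have 1: "mat 1 \<in> SU"
    by (simp add: mem_SU_iff)
  show ?thesis
    unfolding poisson_SU_eq
    using tangent_space_SU[OF assms 1] tangent_space_SU[OF 1 assms]
    by (intro tangent_bivector_diff tangent_bivector_r_SU)
      (auto simp: bounded_linear_Blinfun_apply bounded_linear_matrix_mult_left
        bounded_linear_matrix_mult_right)
qed


section \<open>Bivectors in terms of complex covectors\<close>

definition cdot :: "('n::finite) cvec \<Rightarrow> 'n cvec \<Rightarrow> complex" where
  "cdot a v = (\<Sum>k\<in>UNIV. a $ k * v $ k)"

text \<open>The minus sign comes from Re (a_k i) = - Im a_k.\<close>

definition covector :: "('n::finite) cvec \<Rightarrow>\<^sub>L real \<Rightarrow> 'n cvec" where
  "covector \<alpha> = (\<chi> k. Complex (\<alpha> (axis k 1)) (- \<alpha> (axis k \<i>)))"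

lemma cdot_add_right: "cdot a (v + w) = cdot a v + cdot a w"
  by (simp add: cdot_def sum.distrib distrib_left)

lemma cdot_diff_right: "cdot a (v - w) = cdot a v - cdot a w"
  by (simp add: cdot_def sum_subtractf right_diff_distrib)

lemma cdot_scale_right: "cdot a (c *s v) = c * cdot a v"
  by (simp add: cdot_def sum_distrib_left mult.left_commute)

lemma cdot_scale_left: "cdot (c *s a) v = c * cdot a v"
  by (simp add: cdot_def sum_distrib_left mult.assoc)

lemma cdot_axis [simp]: "cdot a (axis k c) = a $ k * c"
  by (simp add: cdot_def axis_def if_distrib cong: if_cong)

lemma cdot_matrix_mult: "cdot a (M *v v) = cdot (a v* M) v"
proof -
  have "cdot a (M *v v) = (\<Sum>k\<in>UNIV. \<Sum>l\<in>UNIV. a $ k * M $ k $ l * v $ l)"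
    by (simp add: cdot_def matrix_vector_mult_def sum_distrib_left mult.assoc)
  also have "\<dots> = cdot (a v* M) v"
    by (subst sum.swap) (simp add: cdot_def vector_matrix_mult_def sum_distrib_right)
  finally show ?thesis .
qed

text \<open>Both sides are real-linear in v, and \<open>covector\<close> is made to match on the
  real basis of vectors \<open>axis k 1\<close> and \<open>axis k \<i>\<close>.\<close>

lemma blinfun_apply_covector: "blinfun_apply \<alpha> v = Re (cdot (covector \<alpha>) v)"
  for v :: "('n::finite) cvec"
proof -
  have "v = (\<Sum>k\<in>UNIV. Re (v $ k) *\<^sub>R axis k 1 + Im (v $ k) *\<^sub>R axis k \<i>)"
  proof (intro vec_eq_iff[THEN iffD2] allI)
    fix l
    have "(\<Sum>k\<in>UNIV. Re (v $ k) *\<^sub>R axis k 1 + Im (v $ k) *\<^sub>R axis k \<i>) $ l =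
      (\<Sum>k\<in>UNIV. if k = l then v $ l else 0)"
      unfolding sum_component
      by (rule sum.cong) (auto simp: axis_def complex_eq_iff)
    then show "v $ l = (\<Sum>k\<in>UNIV. Re (v $ k) *\<^sub>R axis k 1 + Im (v $ k) *\<^sub>R axis k \<i>) $ l"
      by simp
  qed
  then have "\<alpha> v = \<alpha> (\<Sum>k\<in>UNIV. Re (v $ k) *\<^sub>R axis k 1 + Im (v $ k) *\<^sub>R axis k \<i>)"
    by simp
  also have "\<dots> = Re (cdot (covector \<alpha>) v)"
    by (simp add: blinfun.sum_right blinfun.add_right blinfun.scaleR_right cdot_def covector_def
        mult.commute)
  finally show ?thesis .
qed

text \<open>The form \<Omega> of the overview.\<close>

definition herm_form :: "('n::finite) cvec \<Rightarrow> 'n cvec \<Rightarrow> real" where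
  "herm_form a b = Im (cdot a (\<chi> k. cnj (b $ k)))"

text \<open>This is S_y of the overview: the summand at (i, j) is the value on a, b of the wedge of
  \<open>Xp i j *v y\<close> and \<open>Xm i j *v y\<close>, sorted into sesquilinear and bilinear
  terms.\<close>

definition std_form :: "('n::{finite,linorder}) cvec \<Rightarrow> 'n cvec \<Rightarrow> 'n cvec \<Rightarrow> real" where
  "std_form y a b = Im (\<Sum>(i, j)\<in>{(i, j). i < j}.
     y $ j * cnj (y $ j) * a $ i * cnj (b $ i) - y $ i * cnj (y $ i) * a $ j * cnj (b $ j)
     + y $ i * y $ j * (a $ j * b $ i - a $ i * b $ j))"

lemma mat_unit_mult_vector: "mat_unit i j *v y = axis i (y $ j)"
proof -
  have "(\<Sum>l\<in>UNIV. (if k = i \<and> l = j then 1 else 0) * y $ l) =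
    (\<Sum>l\<in>UNIV. if l = j then (if k = i then y $ j else 0) else 0)" for k
    by (rule sum.cong) auto
  then show ?thesis
    by (auto simp: vec_eq_iff matrix_vector_mult_def mat_unit_def axis_def)
qed

lemma wedge_Xp_Xm:
  assumes "\<And>X. blinfun_apply T X = M *v (X *v y)"
    and ab: "a = covector \<alpha> v* M" "b = covector \<beta> v* M"
  shows "wedge (Xp i j) (Xm i j) (\<alpha> o\<^sub>L T) (\<beta> o\<^sub>L T) =
    Im (y $ j * cnj (y $ j) * a $ i * cnj (b $ i) - y $ i * cnj (y $ i) * a $ j * cnj (b $ j)
     + y $ i * y $ j * (a $ j * b $ i - a $ i * b $ j))"
proof -
  have "Xp i j *v y = axis i (y $ j) - axis j (y $ i)"
    by (simp add: Xp_def matrix_vector_mult_diff_rdistrib mat_unit_mult_vector)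
  then have p: "cdot c (Xp i j *v y) = c $ i * y $ j - c $ j * y $ i" for c
    by (simp add: cdot_diff_right)
  have "Xm i j *v y = mat \<i> *v (axis i (y $ j) + axis j (y $ i))"
    by (simp add: Xm_def matrix_vector_mult_add_rdistrib mat_unit_mult_vector
        flip: matrix_vector_mul_assoc)
  also have "\<dots> = \<i> *s (axis i (y $ j) + axis j (y $ i))"
    by (simp add: vec_eq_iff matrix_vector_mult_def mat_def if_distrib if_distribR distrib_left cong: if_cong)
  finally have m: "cdot c (Xm i j *v y) = \<i> * (c $ i * y $ j + c $ j * y $ i)" for c
    by (simp add: cdot_add_right cdot_scale_right distrib_left)
  \<comment> \<open>Used with p = a_i y_j, q = a_j y_i, r = b_i y_j, t = b_j y_i: \<open>Xp\<close>
    pairs to p - q and r - t, \<open>Xm\<close> to i (p + q) and i (r + t).\<close>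
  have id: "Re (p - q) * Re (\<i> * (r + t)) - Re (\<i> * (p + q)) * Re (r - t) =
    Im (p * cnj r - q * cnj t + (q * r - p * t))" for p q r t :: complex
    by (simp add: algebra_simps)
  have "wedge (Xp i j) (Xm i j) (\<alpha> o\<^sub>L T) (\<beta> o\<^sub>L T) =
    Im (a $ i * y $ j * cnj (b $ i * y $ j) - a $ j * y $ i * cnj (b $ j * y $ i)
      + (a $ j * y $ i * (b $ i * y $ j) - a $ i * y $ j * (b $ j * y $ i)))"
    unfolding wedge_def ab
    by (simp only: blinfun_apply_blinfun_compose assms(1) blinfun_apply_covector
        cdot_matrix_mult[of _ M] p m id)
  also have "\<dots> = Im (y $ j * cnj (y $ j) * a $ i * cnj (b $ i)
      - y $ i * cnj (y $ i) * a $ j * cnj (b $ j)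
      + y $ i * y $ j * (a $ j * b $ i - a $ i * b $ j))"
    by (rule arg_cong[of _ _ Im]) (simp add: algebra_simps)
  finally show ?thesis .
qed

text \<open>The shape X -> M (X y) covers left and right translates at once: M is transferred to the
  covectors and y becomes the base vector of the form.\<close>

lemma map_bivector_r_SU:
  assumes "\<And>X. blinfun_apply T X = M *v (X *v y)"
  shows "map_bivector T r_SU \<alpha> \<beta> = std_form y (covector \<alpha> v* M) (covector \<beta> v* M)"
  unfolding map_bivector_def r_SU_def std_form_def Im_sum
  by (rule sum.cong) (auto simp: wedge_Xp_Xm[OF assms refl refl])

text \<open>The first column of u X is u (X e), with e the first basis vector, and that of X u is X
  applied to the first column of u.\<close>

lemma map_bivector_column_poisson_SU:
  fixes u :: "('n::{finite,linorder}) cmat"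
  shows "map_bivector (Blinfun (column first)) (poisson_SU u) \<alpha> \<beta> =
    std_form (axis first 1) (covector \<alpha> v* u) (covector \<beta> v* u)
    - std_form (column first u) (covector \<alpha>) (covector \<beta>)"
proof -
  have L: "blinfun_apply (Blinfun (column first) o\<^sub>L Blinfun (\<lambda>A. u ** A)) X = u *v (X *v axis first 1)"
    and R: "blinfun_apply (Blinfun (column first) o\<^sub>L Blinfun (\<lambda>A. A ** u)) X = mat 1 *v (X *v column first u)"
    for X :: "'n cmat"
    by (simp_all add: bounded_linear_Blinfun_apply bounded_linear_column column_mult
        bounded_linear_matrix_mult_left bounded_linear_matrix_mult_right column_eq_mult_axis[of _ X])
  show ?thesis
    by (simp only: poisson_SU_eq map_bivector_diff map_bivector_compose map_bivector_r_SU[OF L]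
        map_bivector_r_SU[OF R] vector_matrix_mul_rid)
qed

text \<open>With w = g sigma^-1 the two translates send X to w X sigma and X w sigma = X g. Thus
  sigma survives only in the left term, through w and its own first column.\<close>

lemma map_bivector_column_poisson_sigma:
  fixes g :: "('n::{finite,linorder}) cmat"
  assumes "(sigma c :: 'n cmat) \<in> SU"
  shows "map_bivector (Blinfun (column first)) (poisson_sigma c g) \<alpha> \<beta> =
    std_form (column first (sigma c)) (covector \<alpha> v* (g ** conj_transpose (sigma c)))
      (covector \<beta> v* (g ** conj_transpose (sigma c)))
    - std_form (column first g) (covector \<alpha>) (covector \<beta>)"
proof -
  define w where "w = g ** conj_transpose (sigma c)"
  have w: "w ** sigma c = g"
    using assms by (simp add: w_def mem_SU_iff flip: matrix_mul_assoc)
  have L: "blinfun_apply (Blinfun (column first) o\<^sub>L (Blinfun (\<lambda>A. A ** sigma c) o\<^sub>L Blinfun (\<lambda>A. w ** A))) X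
      = w *v (X *v column first (sigma c))"
    and R: "blinfun_apply (Blinfun (column first) o\<^sub>L (Blinfun (\<lambda>A. A ** sigma c) o\<^sub>L Blinfun (\<lambda>A. A ** w))) X
      = mat 1 *v (X *v column first g)" for X :: "'n cmat"
    by (simp_all add: w bounded_linear_Blinfun_apply bounded_linear_column column_mult
        bounded_linear_matrix_mult_left bounded_linear_matrix_mult_right matrix_vector_mul_assoc
        flip: matrix_mul_assoc)
  show ?thesis
    by (simp only: poisson_sigma_def right_mult_def poisson_SU_eq map_bivector_diff
        map_bivector_compose matrix_inv_SU[OF assms] w_def[symmetric] map_bivector_r_SU[OF L]
        map_bivector_r_SU[OF R] vector_matrix_mul_rid)
qed


section \<open>The extreme indices\<close>

lemma first_le [simp]: "first \<le> k" and le_final [simp]: "k \<le> final"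
  for k :: "'n::{finite,linorder}"
  by (simp_all add: first_def final_def)

lemma first_neq_final: "CARD('n) \<ge> 2 \<Longrightarrow> (first :: 'n::{finite,linorder}) \<noteq> final"
proof
  assume "CARD('n) \<ge> 2" and eq: "(first :: 'n) = final"
  have "k = first" for k :: 'n
    using first_le[of k] le_final[of k] eq by simp
  then have "(UNIV :: 'n set) = {first}"
    by auto
  from arg_cong[OF this, of card] \<open>CARD('n) \<ge> 2\<close> show False
    by simp
qed

section \<open>Transitivity of the special unitary group on the unit sphere\<close>

text \<open>H is multiplied by a unitary diagonal matrix with the phase \<mu> at
  \<open>first\<close>. The entry at \<open>final\<close>, a different index, makes the total
  determinant 1.\<close>

lemma SU_column_of_unitary:
  fixes H :: "('n::{finite,linorder}) cmat"
  assumes H: "conj_transpose H ** H = mat 1" and card: "CARD('n) \<ge> 2" and \<mu>: "norm \<mu> = 1"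
  shows "\<exists>u\<in>SU. column first u = \<mu> *s column first H"
proof -
  define d :: "'n \<Rightarrow> complex" where
    "d k = (if k = first then \<mu> else if k = final then cnj (\<mu> * det H) else 1)" for k
  define D :: "'n cmat" where "D = (\<chi> i j. if i = j then d i else 0)"
  have unit: "z * cnj z = 1" if "norm z = 1" for z
    using complex_norm_square[of z] that by simp
  have "cnj (det H) * det H = 1"
    using arg_cong[OF H, of det] by (simp add: det_mul det_conj_transpose)
  then have "complex_of_real ((norm (det H))\<^sup>2) = 1"
    unfolding complex_norm_square by (simp add: mult.commute)
  then have det_H: "norm (det H) = 1"
    by (metis norm_ge_zero of_real_eq_1_iff power2_eq_1_iff neg_0_le_iff_le not_one_le_zero)
  have "norm (d k) = 1" for k
    using \<mu> det_H by (simp add: d_def norm_mult)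
  then have "cnj (d k) * d k = 1" for k
    using unit[of "d k"] by (simp add: mult.commute)
  moreover have "(conj_transpose D ** D) $ i $ j = (if i = j then cnj (d i) * d i else 0)" for i j
  proof -
    have "(conj_transpose D ** D) $ i $ j =
      (\<Sum>k\<in>UNIV. if k = i then (if i = j then cnj (d i) * d i else 0) else 0)"
      unfolding matrix_matrix_mult_def D_def vec_lambda_beta by (rule sum.cong) auto
    then show ?thesis
      by simp
  qed
  ultimately have "conj_transpose D ** D = mat 1"
    by (simp add: vec_eq_iff mat_def)
  moreover have "conj_transpose (H ** D) ** (H ** D) = conj_transpose D ** (conj_transpose H ** H) ** D"
    by (simp add: conj_transpose_mult matrix_mul_assoc)
  ultimately have unitary: "conj_transpose (H ** D) ** (H ** D) = mat 1"
    by (simp add: H)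
  have "det D = (\<Prod>i\<in>UNIV. d i)"
    by (subst det_diagonal) (simp_all add: D_def)
  also have "\<dots> = (\<Prod>i\<in>{first, final}. d i)"
    by (rule prod.mono_neutral_right) (auto simp: d_def)
  finally have det: "det (H ** D) = 1"
    using first_neq_final[OF card] unit[OF \<mu>] unit[OF det_H]
    by (simp add: det_mul d_def algebra_simps)
  have col_D: "column first D = axis first \<mu>"
    by (simp add: vec_eq_iff column_def D_def axis_def d_def)
  have "(H *v axis first \<mu>) $ i = (\<mu> *s column first H) $ i" for i
  proof -
    have "(H *v axis first \<mu>) $ i = (\<Sum>j\<in>UNIV. if j = (first :: 'n) then \<mu> * H $ i $ first else 0)"
      unfolding matrix_vector_mult_def axis_def vec_lambda_beta by (rule sum.cong) auto
    then show ?thesis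
      by (simp add: column_def)
  qed
  then have "column first (H ** D) = \<mu> *s column first H"
    unfolding column_mult col_D by (simp add: vec_eq_iff)
  then show ?thesis
    using unitary det by (intro bexI[of _ "H ** D"]) (simp_all add: mem_SU_iff)
qed

text \<open>A Householder reflection maps the first basis vector to a unit vector whose first
  coordinate is real and not 1; a phase brings any unit vector to this form.\<close>

lemma SU_transitive:
  fixes x :: "('n::{finite,linorder}) cvec"
  assumes "norm x = 1" and card: "CARD('n) \<ge> 2"
  shows "\<exists>u\<in>SU. column first u = x"
proof -
  define t where "t = norm (x $ first)"
  \<comment> \<open>With this phase the first coordinate of \<open>cnj \<mu> *s x\<close> is -t, so
    the vector v below has first coordinate 1 + t and cannot vanish.\<close>
  obtain \<mu> :: complex where \<mu>: "norm \<mu> = 1" and x1: "x $ first = - (\<mu> * t)"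
  proof (cases "x $ first = 0")
    case True
    then show ?thesis
      using that[of 1] by (simp add: t_def)
  next
    case False
    then show ?thesis
      using that[of "- (x $ first / complex_of_real t)"] by (simp add: t_def norm_divide)
  qed
  have \<mu>\<mu>: "\<mu> * cnj \<mu> = 1"
    using complex_norm_square[of \<mu>] \<mu> by simp
  define v where "v = axis first 1 - cnj \<mu> *s x"
  have t: "t \<ge> 0"
    by (simp add: t_def)
  have v1: "v $ first = 1 + complex_of_real t"
    using \<mu>\<mu> by (simp add: v_def x1 mult.commute mult.left_commute)
  have "(\<Sum>k\<in>UNIV. v $ k * cnj (v $ k)) =
    (\<Sum>k\<in>UNIV. (if k = first then 1 - cnj \<mu> * x $ first - \<mu> * cnj (x $ first) else 0)
      + (\<mu> * cnj \<mu>) * (x $ k * cnj (x $ k)))"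
    by (rule sum.cong) (auto simp: v_def axis_def algebra_simps)
  also have "\<dots> = 1 - cnj \<mu> * x $ first - \<mu> * cnj (x $ first) + (\<mu> * cnj \<mu>) * (norm x)\<^sup>2"
    unfolding norm_cvec_square by (simp add: sum.distrib sum_distrib_left)
  also have "\<dots> = 2 + 2 * complex_of_real t"
    using \<mu>\<mu> assms(1) by (simp add: x1 algebra_simps)
  finally have vv: "(\<Sum>k\<in>UNIV. v $ k * cnj (v $ k)) = 2 + 2 * complex_of_real t" .
  \<comment> \<open>The reflection along v has coefficient 2 / |v|^2, and |v|^2 = 2 + 2 t. As
    v_first = 1 + t, it sends the first basis vector e to e - v.\<close>
  define s :: complex where "s = 1 / (1 + complex_of_real t)"
  have s: "s * (1 + complex_of_real t) = 1" and cnj_s: "cnj s = s"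
    using t by (simp_all add: s_def complex_eq_iff)
  define H :: "'n cmat" where "H = (\<chi> k l. (if k = l then 1 else 0) - s * v $ k * cnj (v $ l))"
  have "(conj_transpose H ** H) $ k $ l = (if k = l then 1 else 0)" for k l
  proof -
    have "(conj_transpose H ** H) $ k $ l =
      (\<Sum>m\<in>UNIV. (if m = k then (if k = l then 1 else 0) - s * v $ k * cnj (v $ l) else 0)
        - (if m = l then s * v $ k * cnj (v $ l) else 0)
        + s * s * v $ k * cnj (v $ l) * (v $ m * cnj (v $ m)))"
      unfolding matrix_matrix_mult_def
      by (auto simp: H_def cnj_s algebra_simps intro!: sum.cong)
    also have "\<dots> = (if k = l then 1 else 0) - 2 * s * v $ k * cnj (v $ l)
        + s * s * v $ k * cnj (v $ l) * (2 + 2 * complex_of_real t)"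
      by (simp add: sum.distrib sum_subtractf vv flip: sum_distrib_left)
    also have "\<dots> = (if k = l then 1 else 0) + 2 * s * v $ k * cnj (v $ l) * (s * (1 + complex_of_real t) - 1)"
      by (simp add: algebra_simps)
    finally show ?thesis
      by (simp add: s)
  qed
  then have H: "conj_transpose H ** H = mat 1"
    by (simp add: vec_eq_iff mat_def)
  have "column first H = axis first 1 - (s * (1 + complex_of_real t)) *s v"
    by (simp add: vec_eq_iff column_def H_def axis_def v1 mult.commute mult.left_commute)
  also have "\<dots> = cnj \<mu> *s x"
    by (simp add: s v_def)
  finally have "\<mu> *s column first H = x"
    using \<mu>\<mu> by (simp add: vec_eq_iff flip: mult.assoc)
  then show ?thesis
    using SU_column_of_unitary[OF H card \<mu>] by simp
qed


section \<open>Explicit formulas for the Poisson structures\<close>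

lemma herm_form_eq: "herm_form a b = Im (\<Sum>k\<in>UNIV. a $ k * cnj (b $ k))"
  by (simp add: herm_form_def cdot_def)

text \<open>Summing over the columns of u first leaves the inner products of its rows, which are
  orthonormal.\<close>

lemma herm_form_SU:
  assumes "u \<in> SU"
  shows "herm_form (a v* u) (b v* u) = herm_form a b"
proof -
  have "(\<Sum>j\<in>UNIV. (a v* u) $ j * cnj ((b v* u) $ j)) =
    (\<Sum>j\<in>UNIV. \<Sum>k\<in>UNIV. \<Sum>l\<in>UNIV. a $ k * cnj (b $ l) * (u $ k $ j * cnj (u $ l $ j)))"
    by (simp add: vector_matrix_mult_def sum_product algebra_simps)
  also have "\<dots> = (\<Sum>k\<in>UNIV. \<Sum>j\<in>UNIV. \<Sum>l\<in>UNIV. a $ k * cnj (b $ l) * (u $ k $ j * cnj (u $ l $ j)))"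
    by (rule sum.swap)
  also have "\<dots> = (\<Sum>k\<in>UNIV. \<Sum>l\<in>UNIV. \<Sum>j\<in>UNIV. a $ k * cnj (b $ l) * (u $ k $ j * cnj (u $ l $ j)))"
    by (intro sum.cong refl sum.swap)
  also have "\<dots> = (\<Sum>k\<in>UNIV. a $ k * cnj (b $ k))"
    by (simp add: SU_orthogonal_rows[OF assms] if_distrib flip: sum_distrib_left cong: if_cong)
  finally show ?thesis
    by (simp add: herm_form_eq)
qed

text \<open>Either index can be made the outer one: the one carrying the sparse coordinates of y in
  \<open>std_form_first_final\<close>, the larger one in
  \<open>sum_less_pairs_split\<close>.\<close>

lemma sum_less_pairs:
  "(\<Sum>(i, j)\<in>{(i, j). i < j}. F i j) = (\<Sum>i\<in>UNIV. \<Sum>j\<in>{i<..}. F i j)"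
  "(\<Sum>(i, j)\<in>{(i, j). i < j}. F i j) = (\<Sum>j\<in>UNIV. \<Sum>i\<in>{..<j}. F i j)"
  for F :: "'n::{finite,linorder} \<Rightarrow> 'n \<Rightarrow> 'a::comm_monoid_add"
proof -
  have "{(i, j). i < j} = Sigma UNIV (\<lambda>i::'n. {i<..})"
    by auto
  then show 1: "(\<Sum>(i, j)\<in>{(i, j). i < j}. F i j) = (\<Sum>i\<in>UNIV. \<Sum>j\<in>{i<..}. F i j)"
    by (simp add: sum.Sigma)
  have "(\<Sum>j\<in>UNIV. \<Sum>i\<in>{..<j}. F i j) = (\<Sum>j\<in>UNIV. \<Sum>i\<in>{i\<in>UNIV. i < j}. F i j)"
    by (intro sum.cong) auto
  also have "\<dots> = (\<Sum>i\<in>UNIV. \<Sum>j\<in>{j\<in>UNIV. i < j}. F i j)"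
    by (rule sum.swap_restrict) simp_all
  also have "\<dots> = (\<Sum>i\<in>UNIV. \<Sum>j\<in>{i<..}. F i j)"
    by (intro sum.cong) auto
  finally show "(\<Sum>(i, j)\<in>{(i, j). i < j}. F i j) = (\<Sum>j\<in>UNIV. \<Sum>i\<in>{..<j}. F i j)"
    by (simp add: 1)
qed

lemma sum_first_final:
  assumes "first \<noteq> (final :: 'n::{finite,linorder})"
    and "\<And>k. k \<noteq> first \<Longrightarrow> k \<noteq> final \<Longrightarrow> h k = 0"
  shows "(\<Sum>k\<in>UNIV. h k) = h first + h (final :: 'n)"
proof -
  have "(\<Sum>k\<in>UNIV. h k) = (\<Sum>k\<in>{first, final}. h k)"
    by (rule sum.mono_neutral_right) (use assms(2) in auto)
  then show ?thesis
    using assms(1) by simp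
qed

text \<open>The coordinates of y vanish except at the extreme indices, for which the range of i < j
  is empty or omits a single index; so full Hermitian sums appear, up to one term each. It is
  applied to the first basis vector and to the first column of sigma.\<close>

lemma std_form_first_final:
  fixes y :: "('n::{finite,linorder}) cvec" and p q :: real
  assumes ff: "first \<noteq> (final :: 'n)" and y: "y = (\<chi> k. if k = first then complex_of_real p
    else if k = final then complex_of_real q else 0)"
  shows "std_form y a b = Im ((q\<^sup>2 - p\<^sup>2) * (\<Sum>k\<in>UNIV. a $ k * cnj (b $ k))
    - q\<^sup>2 * (a $ final * cnj (b $ final)) + p\<^sup>2 * (a $ first * cnj (b $ first))
    + p * q * (a $ final * b $ first - a $ first * b $ final))"
proof -
  define g where "g k = a $ k * cnj (b $ k)" for k
  define K where "K i j = a $ j * b $ i - a $ i * b $ j" for i j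
  have less_first: "{..<first :: 'n} = {}"
    by (simp add: set_eq_iff not_less)
  have final_less: "{final :: 'n<..} = {}"
    by (simp add: set_eq_iff not_less)
  have less_final: "{..<final :: 'n} = UNIV - {final}"
    by (auto simp: less_le)
  have first_less: "{first :: 'n<..} = UNIV - {first}"
    by (auto simp: less_le)
  have yf: "y $ first = p" "y $ final = q" "k \<noteq> first \<Longrightarrow> k \<noteq> final \<Longrightarrow> y $ k = 0" for k
    using ff by (auto simp: y)
  have 1: "(\<Sum>(i, j)\<in>{(i, j). i < j}. y $ j * cnj (y $ j) * g i) = q\<^sup>2 * ((\<Sum>k\<in>UNIV. g k) - g final)"
    unfolding sum_less_pairs(2)
    by (subst sum_first_final[OF ff])
      (simp_all add: yf less_first less_final sum_diff1 power2_eq_square flip: sum_distrib_left)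
  have 2: "(\<Sum>(i, j)\<in>{(i, j). i < j}. y $ i * cnj (y $ i) * g j) = p\<^sup>2 * ((\<Sum>k\<in>UNIV. g k) - g first)"
    unfolding sum_less_pairs(1)
    by (subst sum_first_final[OF ff])
      (simp_all add: yf final_less first_less sum_diff1 power2_eq_square flip: sum_distrib_left)
  have "(\<Sum>j\<in>UNIV - {first}. y $ j * K first j) = (\<Sum>j\<in>{final}. y $ j * K first j)"
    by (rule sum.mono_neutral_right) (use ff yf in auto)
  then have "(\<Sum>j\<in>UNIV - {first}. y $ j * K first j) = q * K first final"
    by (simp add: yf)
  then have 3: "(\<Sum>(i, j)\<in>{(i, j). i < j}. y $ i * y $ j * K i j) = p * q * K first final"
    unfolding sum_less_pairs(1)
    by (subst sum_first_final[OF ff])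
      (simp_all add: yf final_less first_less mult.assoc flip: sum_distrib_left)
  have "std_form y a b = Im ((\<Sum>(i, j)\<in>{(i, j). i < j}. y $ j * cnj (y $ j) * g i)
    - (\<Sum>(i, j)\<in>{(i, j). i < j}. y $ i * cnj (y $ i) * g j)
    + (\<Sum>(i, j)\<in>{(i, j). i < j}. y $ i * y $ j * K i j))"
    unfolding std_form_def g_def K_def
    by (simp add: case_prod_unfold sum.distrib sum_subtractf mult.assoc)
  then show ?thesis
    unfolding 1 2 3 by (simp add: g_def K_def algebra_simps)
qed

text \<open>The first summand is the value of the wedge of x and ix on the covectors a, b.\<close>

definition sphere_form :: "('n::{finite,linorder}) cvec \<Rightarrow> 'n cvec \<Rightarrow> 'n cvec \<Rightarrow> real" where
  "sphere_form x a b = Im (cdot a x * cnj (cdot b x)) - herm_form a b - std_form x a b"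

text \<open>\<open>std_form_first_final\<close> with p = 1, q = 0 evaluates the left translate, and
  \<Omega> is unitarily invariant. The result depends on u only through its first column.\<close>

lemma column_poisson_SU:
  fixes u :: "('n::{finite,linorder}) cmat"
  assumes "u \<in> SU" and "CARD('n) \<ge> 2"
  shows "map_bivector (Blinfun (column first)) (poisson_SU u) \<alpha> \<beta> =
    sphere_form (column first u) (covector \<alpha>) (covector \<beta>)"
proof -
  have nth: "(a v* u) $ first = cdot a (column first u)" for a
    by (simp add: column_eq_mult_axis cdot_matrix_mult)
  have "axis first 1 = (\<chi> k. if k = first then complex_of_real 1
    else if k = (final :: 'n) then complex_of_real 0 else 0)"
    by (auto simp: vec_eq_iff axis_def)
  from std_form_first_final[OF first_neq_final[OF assms(2)] this]
  have "std_form (axis first 1) a b = Im (a $ first * cnj (b $ first)) - herm_form a b"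
    for a b :: "'n cvec"
    by (simp add: herm_form_eq)
  then show ?thesis
    by (simp add: map_bivector_column_poisson_SU sphere_form_def herm_form_SU[OF assms(1)] nth)
qed

text \<open>All matrices with the given first column push to the same bivector, so the definite
  description is meaningful; u itself gives uniqueness.\<close>

lemma poisson_sphere_eq_column:
  fixes u :: "('n::{finite,linorder}) cmat"
  assumes "u \<in> SU" and "CARD('n) \<ge> 2"
  shows "poisson_sphere (column first u) = map_bivector (Blinfun (column first)) (poisson_SU u)"
proof -
  define B where "B = (\<lambda>\<alpha> \<beta>. sphere_form (column first u) (covector \<alpha>) (covector \<beta>))"
  have B: "map_bivector (Blinfun (column first)) (poisson_SU v) = B"
    if "v \<in> SU" "column first v = column first u" for v
    using column_poisson_SU[OF that(1) assms(2)] that(2) by (simp add: B_def fun_eq_iff)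
  have push: "push SU (column first) v (poisson_SU v) = B"
    if "v \<in> SU" "column first v = column first u" for v
    using push_eq[OF bounded_linear_imp_has_derivative[OF bounded_linear_column]
        tangent_bivector_poisson_SU[OF that(1)]] B[OF that] by simp
  have "(THE B. \<forall>v\<in>SU. column first v = column first u \<longrightarrow> B = push SU (column first) v (poisson_SU v)) = B"
    using push assms(1) by (intro the_equality) auto
  then show ?thesis
    using assms B by (simp add: poisson_sphere_def)
qed

lemma poisson_sphere_eq:
  fixes x :: "('m::{finite,linorder}) cvec"
  assumes "x \<in> sphere 0 1"
  shows "poisson_sphere x \<alpha> \<beta> = sphere_form x (covector \<alpha>) (covector \<beta>)"
    and "tangent_bivector (tangent_space (sphere 0 1) x) (poisson_sphere x)"
proof -
  have "poisson_sphere x \<alpha> \<beta> = sphere_form x (covector \<alpha>) (covector \<beta>) \<and>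
    tangent_bivector (tangent_space (sphere 0 1) x) (poisson_sphere x)"
  proof (cases "CARD('m) = 1")
    \<comment> \<open>In complex dimension one there is no pair i < j, and |x_k| = 1 makes the other
      two terms of \<open>sphere_form\<close> cancel.\<close>
    case True
    then obtain k :: 'm where k: "UNIV = {k}"
      by (metis card_1_singletonE)
    then have all: "i = k" for i
      by (metis UNIV_I singletonD)
    have xk: "x $ k * cnj (x $ k) = 1"
      using norm_cvec_square[of x] assms by (simp add: k)
    have "{(i, j). i < (j :: 'm)} = {}"
      by (metis (mono_tags, lifting) all case_prodE Collect_empty_eq order_less_irrefl)
    then have "std_form x a b = 0" for a b
      by (simp add: std_form_def)
    moreover have "cdot a x * cnj (cdot b x) = a $ k * cnj (b $ k) * (x $ k * cnj (x $ k))" for a b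
      by (simp add: cdot_def k)
    ultimately have "sphere_form x a b = 0" for a b
      by (simp add: sphere_form_def herm_form_eq k xk)
    then show ?thesis
      using True by (simp add: poisson_sphere_def tangent_bivector_def)
  next
    case False
    then have card: "CARD('m) \<ge> 2"
      using zero_less_card_finite[where 'a='m] by linarith
    obtain u :: "'m cmat" where u: "u \<in> SU" "column first u = x"
      using SU_transitive[OF _ card] assms by auto
    have sub: "column first ` SU \<subseteq> sphere (0 :: 'm cvec) 1"
      by (auto simp: norm_column_SU)
    have "tangent_bivector (tangent_space (sphere 0 1) x) (poisson_sphere x)"
      unfolding u(2)[symmetric] poisson_sphere_eq_column[OF u(1) card]
      by (rule tangent_bivector_image[OF tangent_bivector_poisson_SU[OF u(1)]])
        (simp add: bounded_linear_Blinfun_apply bounded_linear_column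
          tangent_space_image[OF _ bounded_linear_column sub])
    then show ?thesis
      using poisson_sphere_eq_column[OF u(1) card] column_poisson_SU[OF u(1) card] u(2) by simp
  qed
  then show "poisson_sphere x \<alpha> \<beta> = sphere_form x (covector \<alpha>) (covector \<beta>)"
    and "tangent_bivector (tangent_space (sphere 0 1) x) (poisson_sphere x)"
    by auto
qed

text \<open>sigma is the rotation in the plane of \<open>first\<close> and \<open>final\<close> by
  the angle t with cos t = sqrt c and sin t = - sqrt (1 - c).\<close>

lemma sigma_in_SU:
  assumes "0 \<le> c" "c \<le> 1" "CARD('n::{finite,linorder}) \<ge> 2"
  shows "(sigma c :: 'n cmat) \<in> SU"
    and "column first (sigma c :: 'n cmat) =
      (\<chi> k. if k = first then complex_of_real (sqrt c)
        else if k = final then complex_of_real (sqrt (1 - c)) else 0)"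
proof -
  note ff = first_neq_final[OF assms(3)]
  obtain t where t: "sqrt c = cos t" "- sqrt (1 - c) = sin t"
    using sincos_total_2pi[of "sqrt c" "- sqrt (1 - c)"] assms by auto
  have one: "mat 1 = mat_unit first first + mat_unit final final
      + (\<Sum>i\<in>UNIV - {first, final}. mat_unit i i :: 'n cmat)"
  proof -
    have "(\<Sum>i\<in>UNIV. mat_unit i i) $ k $ l = (mat 1 :: 'n cmat) $ k $ l" for k l
    proof -
      have "(\<Sum>i\<in>UNIV. if k = i \<and> l = i then 1 else (0::complex)) =
        (\<Sum>i\<in>UNIV. if i = k then (if k = l then 1 else 0) else 0)"
        by (rule sum.cong) auto
      then show ?thesis
        by (simp add: mat_unit_def mat_def)
    qed
    then have "mat 1 = (\<Sum>i\<in>UNIV. mat_unit i i :: 'n cmat)"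
      by (simp add: vec_eq_iff)
    also have "\<dots> = (\<Sum>i\<in>{first, final}. mat_unit i i) + (\<Sum>i\<in>UNIV - {first, final}. mat_unit i i)"
      by (rule sum.subset_diff[of "{first, final}" UNIV, simplified add.commute]) auto
    finally show ?thesis
      using ff by simp
  qed
  have rot: "(sigma c :: 'n cmat) = rotation first final (Xp first final) t"
    unfolding sigma_def rotation_def one Xp_def t(1) by (simp add: algebra_simps flip: t(2))
  then show "(sigma c :: 'n cmat) \<in> SU"
    using ff by (simp add: rotation_in_SU)
  show "column first (sigma c :: 'n cmat) =
      (\<chi> k. if k = first then complex_of_real (sqrt c)
        else if k = final then complex_of_real (sqrt (1 - c)) else 0)"
    unfolding rot using ff t(1) minus_equation_iff[THEN iffD1, OF t(2)]
    by (simp add: scaleR_conv_of_real[where 'a=complex] vec_eq_iff column_def rotation_def mat_def mat_unit_def Xp_def)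
qed

text \<open>This gives the Poisson tensor on covectors annihilating the unit vector z, as in
  \<open>column_poisson_sigma\<close>.\<close>

definition CP_form :: "real \<Rightarrow> ('n::{finite,linorder}) cvec \<Rightarrow> 'n cvec \<Rightarrow> 'n cvec \<Rightarrow> real" where
  "CP_form c z a b = (1 - 2 * c) * herm_form a b - std_form z a b"

text \<open>Pulled back by w, the covectors annihilate the first column of sigma, so p a_first = - q
  a_final, and likewise for b. These relations cancel all boundary terms of
  \<open>std_form_first_final\<close> and leave (q^2 - p^2) \<Omega>.\<close>

lemma column_poisson_sigma:
  fixes u :: "('n::{finite,linorder}) cmat"
  assumes u: "u \<in> SU" and c: "0 \<le> c" "c \<le> 1" and card: "CARD('n) \<ge> 2"
    and a0: "cdot (covector \<alpha>) (column first u) = 0" and b0: "cdot (covector \<beta>) (column first u) = 0"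
  shows "map_bivector (Blinfun (column first)) (poisson_sigma c u) \<alpha> \<beta> =
    CP_form c (column first u) (covector \<alpha>) (covector \<beta>)"
proof -
  note \<sigma> = sigma_in_SU[OF c card]
  note ff = first_neq_final[OF card]
  define w where "w = u ** conj_transpose (sigma c)"
  have w: "w \<in> SU"
    using u \<sigma>(1) by (simp add: w_def SU_mult SU_conj_transpose)
  have "w ** sigma c = u"
    using \<sigma>(1) by (simp add: w_def mem_SU_iff flip: matrix_mul_assoc)
  then have ws: "column first u = w *v column first (sigma c)"
    by (metis column_mult)
  define p q where "p = sqrt c" and "q = sqrt (1 - c)"
  have pq: "p\<^sup>2 = c" "q\<^sup>2 = 1 - c"
    using c by (simp_all add: p_def q_def)
  have con: "p * (d v* w) $ first = - (q * (d v* w) $ final)" if "cdot d (column first u) = 0" for d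
  proof -
    have "0 = cdot (d v* w) (column first (sigma c))"
      using that ws by (simp add: cdot_matrix_mult)
    also have "\<dots> = (d v* w) $ first * p + (d v* w) $ final * q"
      unfolding cdot_def \<sigma>(2)
      by (subst sum_first_final[OF ff]) (use ff in \<open>simp_all add: p_def q_def\<close>)
    finally show ?thesis
      by (simp add: eq_neg_iff_add_eq_0 mult.commute)
  qed
  define a b where "a = covector \<alpha> v* w" and "b = covector \<beta> v* w"
  have a: "p * a $ first = - (q * a $ final)" and b: "p * b $ first = - (q * b $ final)"
    unfolding a_def b_def by (rule con a0 b0)+
  have "p\<^sup>2 * (a $ first * cnj (b $ first)) = (p * a $ first) * cnj (p * b $ first)"
    by (simp add: power2_eq_square)
  also have "\<dots> = q\<^sup>2 * (a $ final * cnj (b $ final))"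
    unfolding a b by (simp add: power2_eq_square)
  finally have 1: "p\<^sup>2 * (a $ first * cnj (b $ first)) = q\<^sup>2 * (a $ final * cnj (b $ final))" .
  have "p * q * (a $ final * b $ first - a $ first * b $ final) =
      q * a $ final * (p * b $ first) - (p * a $ first) * (q * b $ final)"
    by (simp add: algebra_simps)
  also have "\<dots> = 0"
    unfolding a b by simp
  finally have 2: "p * q * (a $ final * b $ first - a $ first * b $ final) = 0" .
  have "std_form (column first (sigma c)) a b = Im ((q\<^sup>2 - p\<^sup>2) * (\<Sum>k\<in>UNIV. a $ k * cnj (b $ k)))"
    unfolding std_form_first_final[OF ff \<sigma>(2)[folded p_def q_def]] 1 2 by simp
  also have "\<dots> = (1 - 2 * c) * herm_form a b"
    unfolding herm_form_eq of_real_power[symmetric] pq of_real_diff[symmetric]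
    by simp
  also have "\<dots> = (1 - 2 * c) * herm_form (covector \<alpha>) (covector \<beta>)"
    by (simp add: a_def b_def herm_form_SU[OF w])
  finally show ?thesis
    unfolding map_bivector_column_poisson_sigma[OF \<sigma>(1)] CP_form_def
    by (simp add: a_def b_def flip: w_def)
qed

lemma tangent_bivector_poisson_sigma:
  fixes u :: "('n::{finite,linorder}) cmat"
  assumes "u \<in> SU" and \<sigma>: "(sigma c :: 'n cmat) \<in> SU"
  shows "tangent_bivector (tangent_space SU u) (poisson_sigma c u)"
proof -
  define w where "w = u ** matrix_inv (sigma c)"
  have w: "w \<in> SU"
    using assms by (simp add: w_def matrix_inv_SU SU_mult SU_conj_transpose)
  have "w ** sigma c = u"
    using \<sigma> by (simp add: w_def matrix_inv_SU mem_SU_iff flip: matrix_mul_assoc)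
  moreover have "(\<lambda>A. A ** sigma c) ` SU \<subseteq> (SU :: 'n cmat set)"
    using \<sigma> by (auto simp: SU_mult)
  ultimately have "A ** sigma c \<in> tangent_space SU u" if "A \<in> tangent_space SU w" for A
    using tangent_space_image[OF that bounded_linear_matrix_mult_right] by metis
  then show ?thesis
    unfolding poisson_sigma_def right_mult_def w_def[symmetric]
    by (intro tangent_bivector_image[OF tangent_bivector_poisson_SU[OF w]])
      (simp add: bounded_linear_Blinfun_apply bounded_linear_matrix_mult_right)
qed


section \<open>Affine charts and the nonstandard Poisson structure\<close>

lemma bounded_bilinear_vector_scalar_mult:
  "bounded_bilinear ((*s) :: complex \<Rightarrow> ('n::finite) cvec \<Rightarrow> 'n cvec)"
proof
  show "\<exists>K. \<forall>c (x :: 'n cvec). norm (c *s x) \<le> norm c * norm x * K"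
    by (intro exI[of _ 1]) (simp add: norm_vec_def norm_mult L2_set_right_distrib)
qed (simp_all add: vec_eq_iff algebra_simps)

lemma in_span_singleton: "w \<in> vec.span {z} \<longleftrightarrow> (\<exists>k. w = k *s z)" for z :: "('n::finite) cvec"
  by (auto simp: vec.span_singleton)

lemma span_in_CP: "z \<noteq> 0 \<Longrightarrow> vec.span {z} \<in> CP"
  by (auto simp: CP_def)

lemma span_in_chart_dom_iff: "z \<noteq> 0 \<Longrightarrow> vec.span {z} \<in> chart_dom i \<longleftrightarrow> z $ i \<noteq> 0"
proof -
  assume "z \<noteq> 0"
  have "z $ i \<noteq> 0" if "w \<in> vec.span {z}" "w $ i \<noteq> 0" for w
    using that by (auto simp: in_span_singleton)
  moreover have "z \<in> vec.span {z}"
    by (simp add: vec.span_base)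
  ultimately show ?thesis
    unfolding chart_dom_def using span_in_CP[OF \<open>z \<noteq> 0\<close>] by blast
qed

lemma chart_span:
  assumes "z $ i \<noteq> 0"
  shows "chart i (vec.span {z}) = inverse (z $ i) *s z"
  unfolding chart_def
proof (rule the_equality)
  show "inverse (z $ i) *s z \<in> vec.span {z} \<and> (inverse (z $ i) *s z) $ i = 1"
    using assms by (auto simp: in_span_singleton)
  fix w assume "w \<in> vec.span {z} \<and> w $ i = 1"
  then obtain k where k: "w = k *s z" and "w $ i = 1"
    by (auto simp only: in_span_singleton)
  then have "k * z $ i = 1"
    by simp
  with k show "w = inverse (z $ i) *s z"
    using assms by (metis inverse_unique mult.commute)
qed

text \<open>For z_i nonzero, the derivative at z of w -> w / w_i, the chart expressed in homogeneous
  coordinates.\<close>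

definition chart_deriv :: "'n \<Rightarrow> ('n::finite) cvec \<Rightarrow> 'n cvec \<Rightarrow> 'n cvec" where
  "chart_deriv i z v = inverse (z $ i) *s (v - (v $ i * inverse (z $ i)) *s z)"

lemma chart_deriv_scale [simp]: "z $ i \<noteq> 0 \<Longrightarrow> chart_deriv i z (k *s z) = 0"
  by (simp add: chart_deriv_def vec_eq_iff)

lemma chart_deriv_phase:
  "k \<noteq> 0 \<Longrightarrow> chart_deriv i (k *s z) v = inverse k *s chart_deriv i z v"
  by (cases "z $ i = 0") (simp_all add: chart_deriv_def vec_eq_iff field_simps)

lemma chart_deriv_vector_scalar_mult: "chart_deriv i z (k *s v) = k *s chart_deriv i z v"
  by (simp add: chart_deriv_def vec_eq_iff algebra_simps)

lemma has_derivative_normalize: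
  assumes "z $ i \<noteq> 0"
  shows "((\<lambda>w. inverse (w $ i) *s w) has_derivative chart_deriv i z) (at z within S)"
proof -
  have "((\<lambda>w. w $ i) has_derivative (\<lambda>v. v $ i)) (at z within S)"
    by (rule bounded_linear_imp_has_derivative) (rule bounded_linear_vec_nth)
  note Deriv.has_derivative_inverse[OF assms this]
  from bounded_bilinear.FDERIV[OF bounded_bilinear_vector_scalar_mult this has_derivative_ident]
  show ?thesis
    by (rule has_derivative_eq_rhs) (simp add: chart_deriv_def vec_eq_iff fun_eq_iff algebra_simps)
qed

lemma bounded_linear_chart_deriv: "z $ i \<noteq> 0 \<Longrightarrow> bounded_linear (chart_deriv i z)"
  using has_derivative_normalize[of z i UNIV] by (rule has_derivative_bounded_linear)

lemma has_derivative_chart_span: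
  assumes g: "(g has_derivative G) (at x within M)" and "x \<in> M" and i: "g x $ i \<noteq> 0"
  shows "((\<lambda>y. chart i (vec.span {g y})) has_derivative chart_deriv i (g x) \<circ> G) (at x within M)"
proof -
  have "((\<lambda>y. inverse (g y $ i) *s g y) has_derivative (\<lambda>v. chart_deriv i (g x) (G v))) (at x within M)"
    by (rule has_derivative_compose[OF g has_derivative_normalize[OF i]])
  \<comment> \<open>The chart is given by the normalization only where coordinate i is nonzero;
    continuity provides this near x.\<close>
  moreover have "((\<lambda>y. g y $ i) \<longlongrightarrow> g x $ i) (at x within M)"
    using has_derivative_continuous[OF g] by (auto simp: continuous_within intro: tendsto_vec_nth)
  then have "\<forall>\<^sub>F y in at x within M. g y $ i \<noteq> 0"
    using i by (rule tendsto_imp_eventually_ne)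
  then have "\<forall>\<^sub>F y in at x within M. inverse (g y $ i) *s g y = chart i (vec.span {g y})"
    by eventually_elim (simp add: chart_span)
  ultimately show ?thesis
    unfolding o_def
    by (rule has_derivative_transform_eventually) (use i \<open>x \<in> M\<close> in \<open>simp_all add: chart_span\<close>)
qed

section \<open>The explicit Poisson tensor in charts\<close>

lemma covector_eqI:
  assumes "\<And>v. blinfun_apply \<alpha> v = Re (cdot a v)"
  shows "covector \<alpha> = a"
  using assms[of "axis _ 1"] assms[of "axis _ \<i>"]
  by (simp add: vec_eq_iff covector_def complex_eq_iff)

text \<open>The functional is only real-linear: its values at z and iz give the real and imaginary
  parts of the complex pairing.\<close>

lemma cdot_covector_eq_0:
  assumes "blinfun_apply \<alpha> z = 0" and "blinfun_apply \<alpha> (\<i> *s z) = 0"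
  shows "cdot (covector \<alpha>) z = 0"
  using assms by (simp add: blinfun_apply_covector cdot_scale_right complex_eq_iff)

text \<open>Chart covectors are pulled back to homogeneous coordinates; the results annihilate z,
  which is where \<open>CP_form\<close> is meaningful.\<close>

definition CP_bivector :: "real \<Rightarrow> ('n::{finite,linorder}) cvec \<Rightarrow> 'n cp_bivector" where
  "CP_bivector c z = (\<lambda>i. if z $ i \<noteq> 0
     then (\<lambda>\<alpha> \<beta>. CP_form c z (covector (\<alpha> o\<^sub>L Blinfun (chart_deriv i z)))
       (covector (\<beta> o\<^sub>L Blinfun (chart_deriv i z))))
     else (\<lambda>\<alpha> \<beta>. 0))"

lemma cdot_covector_chart_deriv:
  "z $ i \<noteq> 0 \<Longrightarrow> cdot (covector (\<alpha> o\<^sub>L Blinfun (chart_deriv i z))) z = 0"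
  using chart_deriv_scale[of z i 1]
  by (intro cdot_covector_eq_0)
    (simp_all add: bounded_linear_Blinfun_apply bounded_linear_chart_deriv del: chart_deriv_scale,
     simp add: bounded_linear_Blinfun_apply bounded_linear_chart_deriv)

text \<open>In a chart, \<open>proj_line\<close> is the first-column map followed by normalization;
  the chain rule splits the push-forward accordingly.\<close>

lemma push_CP_poisson_sigma:
  fixes u :: "('n::{finite,linorder}) cmat"
  assumes u: "u \<in> SU" and c: "0 \<le> c" "c \<le> 1" and card: "CARD('n) \<ge> 2"
  shows "push_CP SU proj_line u (poisson_sigma c u) = CP_bivector c (column first u)"
proof
  fix i
  define z where "z = column first u"
  have z0: "z \<noteq> 0"
    using column_neq_0_SU[OF u] by (simp add: z_def)
  show "push_CP SU proj_line u (poisson_sigma c u) i = CP_bivector c (column first u) i"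
  proof (cases "z $ i = 0")
    case True
    then show ?thesis
      using z0
      by (simp add: push_CP_def CP_bivector_def proj_line_def span_in_chart_dom_iff flip: z_def)
  next
    case False
    have der: "((\<lambda>y. chart i (proj_line y)) has_derivative chart_deriv i z \<circ> column (first :: 'n))
      (at u within SU)"
      unfolding proj_line_def z_def
      by (rule has_derivative_chart_span)
        (use u False in \<open>auto simp: z_def bounded_linear_column intro: bounded_linear_imp_has_derivative\<close>)
    have "Blinfun (chart_deriv i z \<circ> column (first :: 'n)) = Blinfun (chart_deriv i z) o\<^sub>L Blinfun (column first)"
      using has_derivative_bounded_linear[OF der]
      by (intro blinfun_eqI)
        (simp add: bounded_linear_Blinfun_apply bounded_linear_chart_deriv bounded_linear_column False)
    then have "push SU (\<lambda>y. chart i (proj_line y)) u (poisson_sigma c u) =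
      map_bivector (Blinfun (chart_deriv i z)) (map_bivector (Blinfun (column first)) (poisson_sigma c u))"
      using push_eq[OF der tangent_bivector_poisson_sigma[OF u sigma_in_SU(1)[OF c card]]]
      by (simp add: map_bivector_compose)
    also have "\<dots> = CP_bivector c z i"
      using column_poisson_sigma[OF u c card] cdot_covector_chart_deriv[OF False] False
      by (simp add: CP_bivector_def map_bivector_def[of "Blinfun (chart_deriv i z)"] flip: z_def)
    finally show ?thesis
      using z0 False by (simp add: push_CP_def proj_line_def span_in_chart_dom_iff flip: z_def)
  qed
qed

text \<open>With l the inverse of k, sesquilinear terms acquire powers of |k| and |l|, which are 1,
  and bilinear terms acquire (k l)^2 = 1.\<close>

lemma CP_form_phase:
  assumes "norm k = 1"
  shows "CP_form c (k *s z) (inverse k *s a) (inverse k *s b) = CP_form c z a b"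
proof -
  define l where "l = inverse k"
  have kl: "k * l = 1"
    using assms unfolding l_def by (intro right_inverse) auto
  have kk: "k * cnj k = 1"
    using complex_norm_square[of k] assms by simp
  have ll: "l * cnj l = 1"
    using complex_norm_square[of l] assms by (simp add: l_def norm_inverse)
  have "herm_form (l *s a) (l *s b) = Im ((l * cnj l) * (\<Sum>k\<in>UNIV. a $ k * cnj (b $ k)))"
    unfolding herm_form_eq by (simp add: sum_distrib_left algebra_simps)
  then have 1: "herm_form (l *s a) (l *s b) = herm_form a b"
    by (simp add: ll herm_form_eq)
  have eq: "(k * p) * cnj (k * p) * (l * r) * cnj (l * s) = p * cnj p * r * cnj s" for p r s
  proof -
    have "(k * p) * cnj (k * p) * (l * r) * cnj (l * s) = (k * cnj k) * (l * cnj l) * (p * cnj p * r * cnj s)"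
      by simp
    then show ?thesis
      by (simp only: kk ll) simp
  qed
  have eq': "(k * p) * (k * q) * ((l * r) * (l * s) - (l * t) * (l * w)) = p * q * (r * s - t * w)" for p q r s t w
  proof -
    have "(k * p) * (k * q) * ((l * r) * (l * s) - (l * t) * (l * w)) = (k * l) * (k * l) * (p * q * (r * s - t * w))"
      by (simp add: algebra_simps)
    then show ?thesis
      by (simp add: kl)
  qed
  have "std_form (k *s z) (l *s a) (l *s b) = std_form z a b"
    unfolding std_form_def vector_smult_component eq eq' ..
  with 1 show ?thesis
    by (simp add: CP_form_def flip: l_def)
qed

text \<open>The chart derivative is homogeneous of degree -1 in z, so pulled-back covectors scale by
  the inverse phase and \<open>CP_form_phase\<close> applies.\<close>

lemma CP_bivector_phase:
  assumes "norm k = 1"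
  shows "CP_bivector c (k *s z) = CP_bivector c z"
proof -
  have k: "k \<noteq> 0"
    using assms by auto
  have "covector (\<alpha> o\<^sub>L Blinfun (chart_deriv i (k *s z))) =
      inverse k *s covector (\<alpha> o\<^sub>L Blinfun (chart_deriv i z))" if "z $ i \<noteq> 0" for \<alpha> i
  proof (rule covector_eqI)
    fix v
    define l where "l = inverse k"
    define \<beta> where "\<beta> = \<alpha> o\<^sub>L Blinfun (chart_deriv i z)"
    have "blinfun_apply (\<alpha> o\<^sub>L Blinfun (chart_deriv i (k *s z))) v = blinfun_apply \<beta> (l *s v)"
      using that k by (simp add: \<beta>_def l_def bounded_linear_Blinfun_apply bounded_linear_chart_deriv
          chart_deriv_phase chart_deriv_vector_scalar_mult)
    also have "\<dots> = Re (cdot (l *s covector \<beta>) v)"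
      by (simp only: blinfun_apply_covector cdot_scale_right cdot_scale_left)
    finally show "blinfun_apply (\<alpha> o\<^sub>L Blinfun (chart_deriv i (k *s z))) v =
        Re (cdot (inverse k *s covector (\<alpha> o\<^sub>L Blinfun (chart_deriv i z))) v)"
      by (simp only: l_def \<beta>_def)
  qed
  then show ?thesis
    using k by (auto simp: CP_bivector_def fun_eq_iff CP_form_phase[OF assms])
qed

text \<open>Any u over the line has a first column differing from z by a phase, which leaves
  \<open>CP_bivector\<close> unchanged; transitivity provides such a u, so the definite description
  has exactly this value.\<close>

lemma tau_eq:
  fixes z :: "('n::{finite,linorder}) cvec"
  assumes z: "norm z = 1" and c: "0 \<le> c" "c \<le> 1" and card: "CARD('n) \<ge> 2"
  shows "tau c (vec.span {z}) = CP_bivector c z"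
proof -
  have push: "push_CP SU proj_line u (poisson_sigma c u) = CP_bivector c z"
    if "u \<in> SU" "proj_line u = vec.span {z}" for u
  proof -
    have "column first u \<in> vec.span {z}"
      using that(2) vec.span_base[of "column first u" "{column first u}"] by (simp add: proj_line_def)
    then obtain k where k: "column first u = k *s z"
      by (auto simp: in_span_singleton)
    have "norm k * norm z = 1"
      using norm_column_SU[OF that(1), of first] unfolding k
      by (simp add: norm_vec_def norm_mult L2_set_right_distrib)
    then have "norm k = 1"
      using z by simp
    then show ?thesis
      using push_CP_poisson_sigma[OF that(1) c card] k by (simp add: CP_bivector_phase)
  qed
  obtain u :: "'n cmat" where u: "u \<in> SU" "column first u = z"
    using SU_transitive[OF z card] by auto
  show ?thesis
    unfolding tau_def
  proof (rule the_equality)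
    show "\<forall>u\<in>SU. proj_line u = vec.span {z} \<longrightarrow> CP_bivector c z = push_CP SU proj_line u (poisson_sigma c u)"
      using push by auto
    show "T = CP_bivector c z"
      if "\<forall>u\<in>SU. proj_line u = vec.span {z} \<longrightarrow> T = push_CP SU proj_line u (poisson_sigma c u)" for T
      using that u push[OF u(1)] by (auto simp: proj_line_def)
  qed
qed


section \<open>Smooth maps\<close>

text \<open>As W is open, equality on W passes to the derivatives at its points, and hence through
  the recursion.\<close>

lemma Ck_on_cong:
  assumes "open W"
  shows "(\<And>x. x \<in> W \<Longrightarrow> f x = g x) \<Longrightarrow> Ck_on k W f \<Longrightarrow> Ck_on k W g"
proof (induction k arbitrary: f g)
  case 0
  then show ?case
    by (simp cong: continuous_on_cong)
next
  case (Suc k)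
  have der: "(g has_derivative frechet_derivative f (at x)) (at x)" if "x \<in> W" for x
  proof -
    have "(f has_derivative frechet_derivative f (at x)) (at x)"
      using Suc.prems(2) that by (simp add: frechet_derivative_works)
    then show ?thesis
      using has_derivative_transform_within_open[OF _ assms that] Suc.prems(1) by blast
  qed
  have "frechet_derivative f (at x) = frechet_derivative g (at x)" if "x \<in> W" for x
    using der[OF that] by (rule frechet_derivative_at)
  then have "Ck_on k W (\<lambda>x. frechet_derivative g (at x) v)" for v
    using Suc.IH[of "\<lambda>x. frechet_derivative f (at x) v"] Suc.prems(2) by simp
  then show ?case
    using der by (auto simp: differentiable_def)
qed

lemma Ck_on_SucI:
  assumes "open W" and "\<And>x. x \<in> W \<Longrightarrow> (f has_derivative f' x) (at x)"
    and "\<And>v. Ck_on k W (\<lambda>x. f' x v)"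
  shows "Ck_on (Suc k) W f"
proof -
  have "f' x = frechet_derivative f (at x)" if "x \<in> W" for x
    using assms(2)[OF that] by (rule frechet_derivative_at)
  then have "Ck_on k W (\<lambda>x. frechet_derivative f (at x) v)" for v
    using Ck_on_cong[OF assms(1) _ assms(3)[of v]] by simp
  then show ?thesis
    using assms(2) by (auto simp: differentiable_def)
qed

lemma Ck_on_SucD:
  assumes "Ck_on (Suc k) W f"
  shows "x \<in> W \<Longrightarrow> (f has_derivative frechet_derivative f (at x)) (at x)"
    and "Ck_on k W (\<lambda>x. frechet_derivative f (at x) v)"
  using assms by (auto simp: frechet_derivative_works)

lemma Ck_on_Suc_imp: "Ck_on (Suc k) W f \<Longrightarrow> Ck_on k W f"
proof (induction k arbitrary: f)
  case 0
  then show ?case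
    by (auto intro!: continuous_at_imp_continuous_on differentiable_imp_continuous_within)
next
  case (Suc k)
  have "Ck_on k W (\<lambda>x. frechet_derivative f (at x) v)" for v
    by (rule Suc.IH, rule Ck_on_SucD(2)[OF Suc.prems])
  then show ?case
    using Suc.prems by auto
qed

lemma Ck_on_const: "open W \<Longrightarrow> Ck_on k W (\<lambda>x. c)"
  by (induction k arbitrary: c) (auto intro!: Ck_on_SucI[where f' = "\<lambda>x v. 0"])

lemma Ck_on_affine:
  assumes "open W" and "bounded_linear L"
  shows "Ck_on k W (\<lambda>x. L x + c)"
proof (cases k)
  case 0
  then show ?thesis
    using linear_continuous_on[OF assms(2)] by (simp add: continuous_on_add)
next
  case (Suc j)
  then show ?thesis
    using assms
    by (auto intro!: Ck_on_SucI[where f' = "\<lambda>x. L"] derivative_eq_intros Ck_on_const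
        bounded_linear_imp_has_derivative simp del: Ck_on.simps)
qed

lemma Ck_on_add:
  assumes "open W"
  shows "Ck_on k W f \<Longrightarrow> Ck_on k W g \<Longrightarrow> Ck_on k W (\<lambda>x. f x + g x)"
proof (induction k arbitrary: f g)
  case 0
  then show ?case
    by (auto intro: continuous_on_add)
next
  case (Suc k)
  show ?case
    by (rule Ck_on_SucI[OF assms has_derivative_add[OF Ck_on_SucD(1)[OF Suc.prems(1)]
            Ck_on_SucD(1)[OF Suc.prems(2)]] Suc.IH[OF Ck_on_SucD(2)[OF Suc.prems(1)]
            Ck_on_SucD(2)[OF Suc.prems(2)]]])
qed

text \<open>The derivative is again a sum of bilinear terms, each with one factor differentiated;
  the other factor is in class k by \<open>Ck_on_Suc_imp\<close>.\<close>

lemma Ck_on_bilinear: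
  assumes "open W" and "bounded_bilinear B"
  shows "Ck_on k W f \<Longrightarrow> Ck_on k W g \<Longrightarrow> Ck_on k W (\<lambda>x. B (f x) (g x))"
proof (induction k arbitrary: f g)
  case 0
  then show ?case
    using bounded_bilinear.continuous_on[OF assms(2)] by auto
next
  case (Suc k)
  note D = Ck_on_SucD[OF Suc.prems(1)] Ck_on_SucD[OF Suc.prems(2)]
  show ?case
    by (rule Ck_on_SucI[OF assms(1) bounded_bilinear.FDERIV[OF assms(2) D(1) D(3)]
          Ck_on_add[OF assms(1)]])
      (auto intro: Suc.IH D(2) D(4) Ck_on_Suc_imp[OF Suc.prems(1)] Ck_on_Suc_imp[OF Suc.prems(2)])
qed

lemma Ck_on_inverse:
  fixes f :: "'a::real_normed_vector \<Rightarrow> 'b::real_normed_field"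
  assumes "open W" and "\<And>x. x \<in> W \<Longrightarrow> f x \<noteq> 0"
  shows "Ck_on k W f \<Longrightarrow> Ck_on k W (\<lambda>x. inverse (f x))"
proof (induction k)
  case 0
  then show ?case
    using assms(2) by (auto intro: continuous_on_inverse)
next
  case (Suc k)
  note D = Ck_on_SucD[OF Suc.prems]
  \<comment> \<open>The sign is written as a constant factor so that the product rule covers the
    whole derivative of the inverse.\<close>
  have "Ck_on k W (\<lambda>x. (- 1) * (inverse (f x) * frechet_derivative f (at x) v * inverse (f x)))" for v
    by (intro Ck_on_bilinear[OF assms(1) bounded_bilinear_mult] Ck_on_const[OF assms(1)] D(2)
        Suc.IH Ck_on_Suc_imp[OF Suc.prems])
  then show ?case
    by (intro Ck_on_SucI[OF assms(1) Deriv.has_derivative_inverse[OF assms(2) D(1)]]) simp_all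
qed

lemma smooth_on_normalize:
  fixes L :: "'a::real_normed_vector \<Rightarrow> ('n::finite) cvec"
  assumes "bounded_linear L"
  shows "open {y. (L y + w) $ i \<noteq> 0}"
    and "smooth_on {y. (L y + w) $ i \<noteq> 0} (\<lambda>y. inverse ((L y + w) $ i) *s (L y + w))"
proof -
  have "continuous_on UNIV (\<lambda>y. (L y + w) $ i)"
    by (intro continuous_intros linear_continuous_on assms)
  from open_Collect_neq[OF this continuous_on_const]
  show op: "open {y. (L y + w) $ i \<noteq> 0}" .
  have "bounded_linear (\<lambda>y. L y $ i)"
    by (rule bounded_linear_compose[OF bounded_linear_vec_nth assms])
  from Ck_on_affine[OF op this, of _ "w $ i"]
  have "Ck_on k {y. (L y + w) $ i \<noteq> 0} (\<lambda>y. (L y + w) $ i)" for k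
    by simp
  then show "smooth_on {y. (L y + w) $ i \<noteq> 0} (\<lambda>y. inverse ((L y + w) $ i) *s (L y + w))"
    unfolding smooth_on_def
    by (intro allI Ck_on_bilinear[OF op bounded_bilinear_vector_scalar_mult]
        Ck_on_inverse[OF op] Ck_on_affine[OF op assms]) auto
qed


section \<open>The embedding\<close>

lemma card_lessThan_less: "x < y \<Longrightarrow> card {..<x} < card {..<y}" for x y :: "'a::{finite,linorder}"
  by (intro psubset_card_mono) (auto simp: psubset_eq)

lemma range_card_lessThan: "range (\<lambda>x :: 'a::{finite,linorder}. card {..<x}) = {..<CARD('a)}"
proof (rule card_subset_eq)
  show "range (\<lambda>x :: 'a. card {..<x}) \<subseteq> {..<CARD('a)}"
    by (auto intro!: psubset_card_mono)
  have "inj (\<lambda>x :: 'a. card {..<x})"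
    by (rule injI) (metis card_lessThan_less neq_iff)
  then show "card (range (\<lambda>x :: 'a. card {..<x})) = card {..<CARD('a)}"
    by (simp add: card_image)
qed simp

text \<open>Each index goes to the one with equally many predecessors. The index
  \<open>final\<close> has CARD('m) predecessors, a rank not attained in the smaller type.\<close>

lemma ex_strict_mono_below_final:
  assumes "CARD('n::{finite,linorder}) = Suc CARD('m::{finite,linorder})"
  shows "\<exists>\<iota> :: 'm \<Rightarrow> 'n. strict_mono \<iota> \<and> range \<iota> = UNIV - {final}"
proof -
  have "\<exists>j :: 'n. card {..<j} = card {..<i}" for i :: 'm
  proof -
    have "card {..<i} < CARD('m)"
      using range_card_lessThan[where 'a = 'm] by blast
    then have "card {..<i} \<in> range (\<lambda>j :: 'n. card {..<j})"
      unfolding range_card_lessThan assms by simp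
    then show ?thesis
      by force
  qed
  then obtain \<iota> :: "'m \<Rightarrow> 'n" where \<iota>: "card {..<\<iota> i} = card {..<i}" for i
    by metis
  have sm: "strict_mono \<iota>"
  proof (rule strict_monoI)
    fix x y :: 'm assume "x < y"
    then have "card {..<\<iota> x} < card {..<\<iota> y}"
      by (simp add: \<iota> card_lessThan_less)
    then show "\<iota> x < \<iota> y"
      using card_lessThan_less[of "\<iota> y" "\<iota> x"] by (metis less_asym neq_iff)
  qed
  have "final \<notin> range \<iota>"
  proof
    assume "final \<in> range \<iota>"
    then obtain i where "final = \<iota> i"
      by blast
    then have "card {..<final :: 'n} < CARD('m)"
      using range_card_lessThan[where 'a = 'm] \<iota>[of i] by auto
    moreover have "{..<final :: 'n} = UNIV - {final}"
      by (auto simp: less_le)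
    ultimately show False
      using assms by (simp add: card_Diff_singleton)
  qed
  then have "range \<iota> \<subseteq> UNIV - {final}"
    by blast
  moreover have "card (range \<iota>) = card (UNIV - {final :: 'n})"
    using assms sm by (simp add: card_image strict_mono_imp_inj_on card_Diff_singleton)
  ultimately have "range \<iota> = UNIV - {final}"
    by (intro card_subset_eq) simp_all
  with sm show ?thesis
    by blast
qed

text \<open>The smaller index set is identified with all indices but the last. The order must be
  kept because r is a sum over i < j.\<close>

locale order_embedding =
  fixes \<iota> :: "'m::{finite,linorder} \<Rightarrow> 'n::{finite,linorder}"
  assumes strict_mono: "strict_mono \<iota>" and range: "range \<iota> = UNIV - {final}"
begin

lemma inj: "inj \<iota>"
  using strict_mono by (rule strict_mono_imp_inj_on)

lemma neq_final [simp]: "\<iota> i \<noteq> final"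
  using range by (metis DiffD2 rangeI singletonI)

lemma sum_split: "(\<Sum>k\<in>UNIV. h k) = (\<Sum>i\<in>UNIV. h (\<iota> i)) + h final"
  for h :: "'n \<Rightarrow> 'a::comm_monoid_add"
proof -
  have "(\<Sum>k\<in>UNIV. h k) = h final + (\<Sum>k\<in>UNIV - {final}. h k)"
    by (simp add: sum.remove)
  then show ?thesis
    unfolding range[symmetric] by (simp add: sum.reindex[OF inj] add.commute)
qed

text \<open>The added index is the greatest, so it occurs only as the second entry of a
  pair.\<close>

lemma sum_less_pairs_split:
  "(\<Sum>(i, j)\<in>{(i, j). i < j}. F i j) =
    (\<Sum>(i, j)\<in>{(i, j). i < j}. F (\<iota> i) (\<iota> j)) + (\<Sum>i\<in>UNIV. F (\<iota> i) final)"
  for F :: "'n \<Rightarrow> 'n \<Rightarrow> 'a::comm_monoid_add"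
proof -
  have "{..<\<iota> j} = \<iota> ` {..<j}" for j
  proof
    show "{..<\<iota> j} \<subseteq> \<iota> ` {..<j}"
    proof
      fix k assume k: "k \<in> {..<\<iota> j}"
      then have "k \<noteq> final"
        by (metis le_final leD lessThan_iff)
      then obtain i where "k = \<iota> i"
        using range by auto
      then show "k \<in> \<iota> ` {..<j}"
        using k strict_mono_less[OF strict_mono] by auto
    qed
  qed (use strict_mono_less[OF strict_mono] in auto)
  moreover have "{..<final} = range \<iota>"
    unfolding range by (auto simp: less_le)
  ultimately show ?thesis
    unfolding sum_less_pairs(2) sum_split
    by (simp add: sum.reindex inj inj_on_subset[OF inj])
qed

definition extend :: "'m cvec \<Rightarrow> 'n cvec" where
  "extend x = (\<chi> k. if k = final then 0 else x $ inv \<iota> k)"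

lemma extend_nth [simp]: "extend x $ \<iota> i = x $ i" "extend x $ final = 0"
  by (simp_all add: extend_def inv_f_f[OF inj])

lemma bounded_linear_extend: "bounded_linear extend"
  by (auto simp: linear_conv_bounded_linear[symmetric] extend_def vec_eq_iff intro!: linearI)

lemma cdot_extend: "cdot a (extend x) = cdot (\<chi> i. a $ \<iota> i) x"
  by (simp add: cdot_def sum_split)

text \<open>A representative of the image line with constant last coordinate, so that for c < 1 it
  can be recovered from the line.\<close>

definition lift :: "real \<Rightarrow> 'm cvec \<Rightarrow> 'n cvec" where
  "lift c x = sqrt c *\<^sub>R extend x + axis final (complex_of_real (sqrt (1 - c)))"

lemma lift_nth [simp]:
  "lift c x $ \<iota> i = complex_of_real (sqrt c) * x $ i"
  "lift c x $ final = complex_of_real (sqrt (1 - c))"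
  by (simp_all add: lift_def axis_def scaleR_conv_of_real[where 'a = complex])

lemma norm_lift:
  assumes "0 \<le> c" "c \<le> 1" "norm x = 1"
  shows "norm (lift c x) = 1"
proof -
  define p q where "p = sqrt c" and "q = sqrt (1 - c)"
  have pq: "p\<^sup>2 = c" "q\<^sup>2 = 1 - c"
    using assms by (simp_all add: p_def q_def)
  have "complex_of_real ((norm (lift c x))\<^sup>2) =
    (\<Sum>i\<in>UNIV. complex_of_real (p\<^sup>2) * (x $ i * cnj (x $ i))) + complex_of_real (q\<^sup>2)"
    unfolding norm_cvec_square sum_split
    by (simp add: p_def[symmetric] q_def[symmetric] power2_eq_square algebra_simps)
  also have "\<dots> = complex_of_real (p\<^sup>2) * complex_of_real ((norm x)\<^sup>2) + complex_of_real (q\<^sup>2)"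
    unfolding norm_cvec_square by (simp add: sum_distrib_left)
  also have "\<dots> = 1"
    unfolding pq assms(3) by simp
  finally show ?thesis
    by (metis norm_ge_zero of_real_eq_1_iff power2_eq_1_iff neg_0_le_iff_le not_one_le_zero)
qed

text \<open>With W the Hermitian sum over the smaller index set, collecting terms leaves Im ((1 - c)
  a_n cnj b_n - c W) besides - S_x. The annihilation conditions turn the first part into the wedge
  of x and ix, and the second is - \<Omega> on the scaled covectors.\<close>

lemma CP_form_lift:
  assumes c: "0 \<le> c" "c \<le> 1" and x: "norm x = 1"
    and a0: "cdot a (lift c x) = 0" and b0: "cdot b (lift c x) = 0"
  shows "CP_form c (lift c x) a b =
    sphere_form x (\<chi> i. sqrt c *\<^sub>R a $ \<iota> i) (\<chi> i. sqrt c *\<^sub>R b $ \<iota> i)"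
proof -
  define p q where "p = complex_of_real (sqrt c)" and "q = complex_of_real (sqrt (1 - c))"
  have pp: "p * p = complex_of_real c" and qq: "q * q = complex_of_real (1 - c)"
    using c by (simp_all add: p_def q_def flip: of_real_mult)
  have cnj: "cnj p = p" "cnj q = q"
    by (simp_all add: p_def q_def)
  have scale: "sqrt c *\<^sub>R w = p * w" for w
    by (simp add: p_def scaleR_conv_of_real)
  have nth: "lift c x $ \<iota> i = p * x $ i" "lift c x $ final = q" for i
    by (simp_all add: p_def q_def)
  define s t where "s = (\<Sum>i\<in>UNIV. a $ \<iota> i * x $ i)" and "t = (\<Sum>i\<in>UNIV. b $ \<iota> i * x $ i)"
  define W where "W = (\<Sum>i\<in>UNIV. a $ \<iota> i * cnj (b $ \<iota> i))"
  define an bn where "an = a $ final" and "bn = b $ final"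
  \<comment> \<open>Annihilation of the lifted vector, solved for the last components.\<close>
  have an: "q * an = - (p * s)" and bn: "q * bn = - (p * t)"
    using a0 b0 by (simp_all add: cdot_def sum_split nth s_def t_def an_def bn_def eq_neg_iff_add_eq_0
        sum_distrib_left algebra_simps del: lift_nth)
  have xx: "(\<Sum>i\<in>UNIV. x $ i * cnj (x $ i)) = 1"
    using norm_cvec_square[of x] x by simp
  define a' b' where "a' = (\<chi> i. sqrt c *\<^sub>R a $ \<iota> i)" and "b' = (\<chi> i. sqrt c *\<^sub>R b $ \<iota> i)"
  have a'b': "a' $ i = p * a $ \<iota> i" "b' $ i = p * b $ \<iota> i" for i
    by (simp_all add: a'_def b'_def scale)
  have "(\<Sum>i\<in>UNIV. q * cnj q * a $ \<iota> i * cnj (b $ \<iota> i)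
      - (p * x $ i) * cnj (p * x $ i) * an * cnj bn
      + (p * x $ i) * q * (an * b $ \<iota> i - a $ \<iota> i * bn)) =
    (\<Sum>i\<in>UNIV. (q * q) * (a $ \<iota> i * cnj (b $ \<iota> i)) - (p * p * an * cnj bn) * (x $ i * cnj (x $ i))
      + p * q * an * (b $ \<iota> i * x $ i) - p * q * bn * (a $ \<iota> i * x $ i))"
    by (rule sum.cong) (simp_all add: cnj algebra_simps)
  also have "\<dots> = q * q * W - p * p * an * cnj bn + p * q * an * t - p * q * bn * s"
    by (simp add: sum.distrib sum_subtractf W_def s_def t_def xx flip: sum_distrib_left)
  \<comment> \<open>Both products equal - p^2 s t, so the mixed bilinear terms cancel.\<close>
  also have "p * q * an * t = p * q * bn * s"
  proof -
    have "p * q * an * t = p * (q * an) * t" "p * q * bn * s = p * (q * bn) * s"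
      by simp_all
    then show ?thesis
      unfolding an bn by simp
  qed
  finally have last: "(\<Sum>i\<in>UNIV. q * cnj q * a $ \<iota> i * cnj (b $ \<iota> i)
      - (p * x $ i) * cnj (p * x $ i) * an * cnj bn
      + (p * x $ i) * q * (an * b $ \<iota> i - a $ \<iota> i * bn)) = q * q * W - p * p * an * cnj bn"
    by simp
  \<comment> \<open>For pairs below \<open>final\<close> the factor p^2 from the lift is absorbed by
    the scaled covectors; the pairs with \<open>final\<close> contribute
    \<open>last\<close>.\<close>
  have std: "std_form (lift c x) a b = std_form x a' b' + Im (q * q * W - p * p * an * cnj bn)"
    unfolding std_form_def sum_less_pairs_split nth an_def[symmetric] bn_def[symmetric] last a'b'
      plus_complex.sel
    by (intro arg_cong2[of _ _ _ _ "(+)"] arg_cong[of _ _ Im] sum.cong)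
      (auto simp: cnj algebra_simps)
  have "q * q * (an * cnj bn) = (q * an) * cnj (q * bn)"
    by (simp add: cnj)
  also have "\<dots> = p * p * (s * cnj t)"
    unfolding an bn by (simp add: cnj)
  finally have abn: "complex_of_real (1 - c) * (an * cnj bn) = complex_of_real c * (s * cnj t)"
    unfolding pp qq .
  have "CP_form c (lift c x) a b + std_form x a' b' =
    Im (complex_of_real (1 - 2 * c) * (W + an * cnj bn) - complex_of_real (1 - c) * W
      + complex_of_real c * (an * cnj bn))"
    unfolding CP_form_def std herm_form_eq sum_split W_def[symmetric] an_def[symmetric]
      bn_def[symmetric] qq pp by (simp add: algebra_simps)
  also have "\<dots> = Im (complex_of_real (1 - c) * (an * cnj bn) - complex_of_real c * W)"
    by (rule arg_cong[of _ _ Im]) (simp add: algebra_simps)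
  also have "\<dots> = Im (complex_of_real c * (s * cnj t) - complex_of_real c * W)"
    unfolding abn ..
  also have "\<dots> = Im (cdot a' x * cnj (cdot b' x)) - herm_form a' b'"
  proof -
    have "cdot a' x = p * s" "cdot b' x = p * t"
      by (simp_all add: cdot_def a'b' s_def t_def sum_distrib_left mult.assoc)
    then have 1: "cdot a' x * cnj (cdot b' x) = p * p * (s * cnj t)"
      by (simp add: cnj)
    have "(\<Sum>i\<in>UNIV. a' $ i * cnj (b' $ i)) = p * p * W"
      by (simp add: a'b' cnj W_def sum_distrib_left algebra_simps)
    then show ?thesis
      unfolding herm_form_eq 1 pp by simp
  qed
  finally show ?thesis
    by (simp add: sphere_form_def a'_def b'_def)
qed

section \<open>The map into projective space\<close>

definition embed :: "real \<Rightarrow> 'm cvec \<Rightarrow> 'n cvec set" where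
  "embed c x = vec.span {lift c x}"

lemma lift_neq_0: "c < 1 \<Longrightarrow> lift c x \<noteq> 0"
  by (metis diff_gt_0_iff_gt lift_nth(2) of_real_eq_0_iff order_less_irrefl real_sqrt_gt_zero zero_index)

lemma bounded_linear_scale_extend: "bounded_linear (\<lambda>x. sqrt c *\<^sub>R extend x)"
  by (rule bounded_linear_compose[OF bounded_linear_scaleR_right bounded_linear_extend])

lemma has_derivative_lift: "(lift c has_derivative (\<lambda>v. sqrt c *\<^sub>R extend v)) (at x within S)"
  unfolding lift_def[abs_def]
  by (rule derivative_eq_intros refl bounded_linear_imp_has_derivative
      bounded_linear_scale_extend | simp)+

lemma has_derivative_chart_embed:
  assumes "x \<in> M" and "lift c x $ i \<noteq> 0"
  shows "((\<lambda>y. chart i (embed c y)) has_derivative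
    (\<lambda>v. chart_deriv i (lift c x) (sqrt c *\<^sub>R extend v))) (at x within M)"
  using has_derivative_chart_span[OF has_derivative_lift assms] by (simp add: embed_def o_def)

lemma embed_in_chart_dom_iff: "c < 1 \<Longrightarrow> embed c x \<in> chart_dom i \<longleftrightarrow> lift c x $ i \<noteq> 0"
  by (simp add: embed_def span_in_chart_dom_iff lift_neq_0)

lemma smooth_map_embed:
  assumes "c < 1"
  shows "smooth_map_CP M (embed c)"
  unfolding smooth_map_CP_def
proof (intro conjI ballI allI impI)
  show "embed c ` M \<subseteq> CP"
    using assms by (auto simp: embed_def span_in_CP lift_neq_0)
  fix x i assume "x \<in> M" and x: "embed c x \<in> chart_dom i"
  define w :: "'n cvec" where "w = axis final (complex_of_real (sqrt (1 - c)))"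
  have lift: "lift c y = sqrt c *\<^sub>R extend y + w" for y
    by (simp add: lift_def w_def)
  note smooth = smooth_on_normalize[OF bounded_linear_scale_extend, of c w i, folded lift]
  have "\<forall>y\<in>M \<inter> {y. lift c y $ i \<noteq> 0}.
      embed c y \<in> chart_dom i \<and> chart i (embed c y) = inverse (lift c y $ i) *s lift c y"
    using assms by (auto simp: embed_in_chart_dom_iff) (simp add: embed_def chart_span)
  moreover have "x \<in> {y. lift c y $ i \<noteq> 0}"
    using x assms by (simp add: embed_in_chart_dom_iff)
  ultimately show "\<exists>W g. open W \<and> x \<in> W \<and> smooth_on W g \<and>
      (\<forall>y\<in>M \<inter> W. embed c y \<in> chart_dom i \<and> chart i (embed c y) = g y)"
    using smooth by blast
qed

text \<open>The kernel of the chart derivative is the complex line of z. The last coordinate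
  vanishes on extended vectors but not on z, so they meet the kernel only in 0.\<close>

lemma immersion_embed:
  assumes "0 < c" "c < 1"
  shows "immersion_CP M (embed c)"
  unfolding immersion_CP_def
proof (intro ballI allI impI inj_onI)
  fix x i v w
  assume "x \<in> M" and "embed c x \<in> chart_dom i"
    and v: "v \<in> tangent_space M x" and w: "w \<in> tangent_space M x"
    and eq: "frechet_derivative (\<lambda>y. chart i (embed c y)) (at x within M) v =
      frechet_derivative (\<lambda>y. chart i (embed c y)) (at x within M) w"
  then have i: "lift c x $ i \<noteq> 0"
    using assms by (simp add: embed_in_chart_dom_iff)
  note der = has_derivative_chart_embed[OF \<open>x \<in> M\<close> i]
  have "((\<lambda>y. chart i (embed c y)) has_derivative
      frechet_derivative (\<lambda>y. chart i (embed c y)) (at x within M)) (at x within M)"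
    using der by (metis differentiableI frechet_derivative_works)
  note unique = has_derivative_tangent_unique[OF this der]
  define z where "z = lift c x"
  define h where "h = extend v - extend w"
  have "chart_deriv i z (sqrt c *\<^sub>R extend v) = chart_deriv i z (sqrt c *\<^sub>R extend w)"
    using unique[OF v] unique[OF w] eq by (simp add: z_def)
  then have "chart_deriv i z (sqrt c *\<^sub>R h) = 0"
    using bounded_linear_chart_deriv[of z i] i
    by (simp add: h_def z_def scaleR_right_diff_distrib linear_simps)
  then have "sqrt c *\<^sub>R h = ((sqrt c *\<^sub>R h) $ i * inverse (z $ i)) *s z"
    using i by (simp add: chart_deriv_def vec_eq_iff z_def mult.assoc)
  then obtain k where k: "sqrt c *\<^sub>R h = k *s z"
    by blast
  then have "(sqrt c *\<^sub>R h) $ final = k * z $ final"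
    by simp
  then have "k = 0"
    using assms by (simp add: h_def z_def)
  then have "h = 0"
    using k assms by simp
  then have "extend v $ \<iota> j = extend w $ \<iota> j" for j
    by (simp add: h_def)
  then show "v = w"
    by (simp add: vec_eq_iff)
qed

lemma chart_final_embed:
  assumes "c < 1"
  shows "chart final (embed c x) = inverse (complex_of_real (sqrt (1 - c))) *s lift c x"
  using assms by (simp add: embed_def chart_span)

text \<open>The whole image lies in the chart at \<open>final\<close>, where rescaled coordinates
  give a continuous inverse.\<close>

lemma embedding_map_embed:
  assumes c: "0 < c" "c < 1"
  shows "embedding_map (top_of_set M) CP_topology (embed c)"
proof -
  \<comment> \<open>The chart divides by sqrt (1 - c) and the lift multiplies by sqrt c; q undoes
    both.\<close>
  define q where "q = complex_of_real (sqrt (1 - c) / sqrt c)"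
  define g :: "'n cvec set \<Rightarrow> 'm cvec" where "g p = (\<chi> j. q * chart final p $ \<iota> j)" for p
  have "q * inverse (complex_of_real (sqrt (1 - c))) * complex_of_real (sqrt c) = 1"
    using c by (simp add: q_def field_simps)
  then have "q * (inverse (complex_of_real (sqrt (1 - c))) * (complex_of_real (sqrt c) * y)) = y" for y
    by (metis mult.assoc mult.left_neutral)
  then have g_embed: "g (embed c x) = x" for x
    using c by (simp add: g_def chart_final_embed vec_eq_iff)
  have top: "topspace CP_topology = (CP :: 'n cvec set set)"
  proof -
    have "{z :: 'n cvec. z \<noteq> 0 \<and> vec.span {z} \<in> CP} = - {0}"
      using span_in_CP by blast
    then have "openin CP_topology (CP :: 'n cvec set set)"
      by (simp add: openin_CP_topology open_Compl)
    then show ?thesis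
      using openin_CP_topology[of "topspace CP_topology :: 'n cvec set set"]
      by (metis openin_subset openin_topspace subset_antisym)
  qed
  have embed_CP: "embed c x \<in> CP" for x
    using c by (simp add: embed_def span_in_CP lift_neq_0)
  have cont_lift: "continuous_on UNIV (lift c)"
    by (rule has_derivative_continuous_on) (rule has_derivative_lift)
  have "continuous_map (top_of_set M) CP_topology (embed c)"
    unfolding continuous_map_def
  proof (intro conjI allI impI)
    show "embed c \<in> topspace (top_of_set M) \<rightarrow> topspace CP_topology"
      by (simp add: top embed_CP)
    fix U :: "'n cvec set set"
    assume "openin CP_topology U"
    then have "open {z. z \<noteq> 0 \<and> vec.span {z} \<in> U}"
      by (simp add: openin_CP_topology)
    then have "open (lift c -` {z. z \<noteq> 0 \<and> vec.span {z} \<in> U})"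
      using cont_lift by (rule open_vimage)
    moreover have "lift c -` {z. z \<noteq> 0 \<and> vec.span {z} \<in> U} = {x. embed c x \<in> U}"
      using c by (auto simp: embed_def lift_neq_0)
    ultimately show "openin (top_of_set M) {x \<in> topspace (top_of_set M). embed c x \<in> U}"
      by (auto simp: openin_open)
  qed
  moreover have "continuous_map (subtopology CP_topology (embed c ` M)) (top_of_set M) g"
    unfolding continuous_map_def
  proof (intro conjI allI impI)
    show "g \<in> topspace (subtopology CP_topology (embed c ` M)) \<rightarrow> topspace (top_of_set M)"
      by (auto simp: g_embed)
    fix U assume "openin (top_of_set M) U"
    then obtain V where V: "open V" "U = M \<inter> V"
      by (auto simp: openin_open)
    \<comment> \<open>An open set of projective space cutting out the preimage under g: restricted
      to the chart domain, g is an explicit continuous function of homogeneous coordinates.\<close>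
    define T where "T = {p \<in> chart_dom final. g p \<in> V}"
    have "continuous_on {z. z $ final \<noteq> 0} (\<lambda>z. \<chi> j. q * (inverse (z $ final) * z $ \<iota> j))"
      by (auto intro!: continuous_intros)
    moreover have "open {z :: 'n cvec. z $ final \<noteq> 0}"
      by (rule open_Collect_neq) (auto intro!: continuous_intros)
    ultimately have "open ((\<lambda>z. \<chi> j. q * (inverse (z $ final) * z $ \<iota> j)) -` V \<inter> {z. z $ final \<noteq> 0})"
      using V(1) by (simp add: continuous_on_open_vimage)
    moreover have "vec.span {z} \<in> chart_dom final" if "z $ final \<noteq> 0" for z :: "'n cvec"
      using that span_in_chart_dom_iff[of z final] by (cases "z = 0") auto
    then have "{z. z \<noteq> 0 \<and> vec.span {z} \<in> T} =
        (\<lambda>z. \<chi> j. q * (inverse (z $ final) * z $ \<iota> j)) -` V \<inter> {z. z $ final \<noteq> 0}"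
      by (auto simp: T_def g_def span_in_chart_dom_iff chart_span)
    ultimately have "openin CP_topology T"
      by (auto simp: openin_CP_topology T_def chart_dom_def)
    moreover have "{p \<in> topspace (subtopology CP_topology (embed c ` M)). g p \<in> U} = T \<inter> embed c ` M"
      using c by (auto simp: top embed_CP T_def V(2) g_embed embed_in_chart_dom_iff)
    ultimately show "openin (subtopology CP_topology (embed c ` M))
        {p \<in> topspace (subtopology CP_topology (embed c ` M)). g p \<in> U}"
      by (auto simp: openin_subtopology)
  qed
  ultimately have "homeomorphic_maps (top_of_set M) (subtopology CP_topology (embed c ` M)) (embed c) g"
    by (auto simp: homeomorphic_maps_def continuous_map_in_subtopology g_embed)
  then show ?thesis
    unfolding embedding_map_def homeomorphic_map_maps by auto
qed

text \<open>Pulling chart covectors back to the sphere amounts to restricting their homogeneous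
  versions to the first indices and scaling by sqrt c, exactly the covectors in
  \<open>CP_form_lift\<close>.\<close>

lemma push_CP_embed:
  assumes c: "0 \<le> c" "c < 1" and x: "x \<in> sphere 0 1"
  shows "push_CP (sphere 0 1) (embed c) x (poisson_sphere x) = CP_bivector c (lift c x)"
proof
  fix i
  show "push_CP (sphere 0 1) (embed c) x (poisson_sphere x) i = CP_bivector c (lift c x) i"
  proof (cases "lift c x $ i = 0")
    case True
    then show ?thesis
      using c by (simp add: push_CP_def CP_bivector_def embed_in_chart_dom_iff)
  next
    case False
    define D where "D = chart_deriv i (lift c x)"
    note der = has_derivative_chart_embed[OF x False, folded D_def]
    have D: "bounded_linear D"
      using False by (simp add: D_def bounded_linear_chart_deriv)
    have cov: "covector (\<alpha> o\<^sub>L Blinfun (\<lambda>v. D (sqrt c *\<^sub>R extend v))) =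
        (\<chi> i. sqrt c *\<^sub>R covector (\<alpha> o\<^sub>L Blinfun D) $ \<iota> i)" for \<alpha>
    proof (rule covector_eqI)
      fix v
      have "blinfun_apply (\<alpha> o\<^sub>L Blinfun (\<lambda>v. D (sqrt c *\<^sub>R extend v))) v =
          blinfun_apply (\<alpha> o\<^sub>L Blinfun D) (sqrt c *\<^sub>R extend v)"
        using has_derivative_bounded_linear[OF der] D by (simp add: bounded_linear_Blinfun_apply)
      also have "\<dots> = sqrt c * Re (cdot (covector (\<alpha> o\<^sub>L Blinfun D)) (extend v))"
        by (simp add: blinfun.scaleR_right flip: blinfun_apply_covector del: blinfun_apply_blinfun_compose)
      also have "\<dots> = Re (cdot (\<chi> i. sqrt c *\<^sub>R covector (\<alpha> o\<^sub>L Blinfun D) $ \<iota> i) v)"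
        by (simp add: cdot_extend) (simp add: cdot_def sum_distrib_left)
      finally show "blinfun_apply (\<alpha> o\<^sub>L Blinfun (\<lambda>v. D (sqrt c *\<^sub>R extend v))) v =
        Re (cdot (\<chi> i. sqrt c *\<^sub>R covector (\<alpha> o\<^sub>L Blinfun D) $ \<iota> i) v)" .
    qed
    have "push (sphere 0 1) (\<lambda>y. chart i (embed c y)) x (poisson_sphere x) \<alpha> \<beta> =
        CP_form c (lift c x) (covector (\<alpha> o\<^sub>L Blinfun D)) (covector (\<beta> o\<^sub>L Blinfun D))" for \<alpha> \<beta>
      unfolding push_eq[OF der poisson_sphere_eq(2)[OF x]] map_bivector_def
        poisson_sphere_eq(1)[OF x] cov
      using c x False by (subst CP_form_lift) (simp_all add: D_def cdot_covector_chart_deriv)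
    then show ?thesis
      using False c by (simp add: push_CP_def CP_bivector_def embed_in_chart_dom_iff D_def fun_eq_iff)
  qed
qed

end

theorem theorem4:
  fixes n :: nat and c :: real
  assumes "n \<ge> 2" and "0 < c" and "c < 1"
    and "CARD('n::{finite,linorder}) = n" and "CARD('m::{finite,linorder}) = n - 1"
  shows "\<exists>f :: 'm cvec \<Rightarrow> 'n cvec set.
      smooth_embedding_CP (sphere 0 1) f \<and>
      (\<forall>x\<in>sphere 0 1. push_CP (sphere 0 1) f x (poisson_sphere x) = tau c (f x))"
proof -
  have "CARD('n) = Suc CARD('m)"
    using assms by simp
  then obtain \<iota> :: "'m \<Rightarrow> 'n" where "strict_mono \<iota>" "range \<iota> = UNIV - {final}"
    using ex_strict_mono_below_final by blast
  then interpret order_embedding \<iota>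
    by unfold_locales
  have "smooth_embedding_CP (sphere 0 1) (embed c)"
    using assms smooth_map_embed immersion_embed embedding_map_embed
    by (simp add: smooth_embedding_CP_def)
  moreover have "push_CP (sphere 0 1) (embed c) x (poisson_sphere x) = tau c (embed c x)"
    if "x \<in> sphere 0 1" for x
  proof -
    have "tau c (embed c x) = CP_bivector c (lift c x)"
      unfolding embed_def
      by (rule tau_eq) (use that assms in \<open>simp_all add: norm_lift\<close>)
    then show ?thesis
      using push_CP_embed[of c x] that assms by simp
  qed
  ultimately show ?thesis
    by blast
qed

end
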